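(* Let $(\underline{\mathcal{H}},\overline{\mathcal{H}},\lambda)$, with $\underline{\mathcal{H}}=(H,m,e)$ and $\overline{\mathcal{H}}=(H,\delta,\varepsilon)$, be a monad-comonad triple on a Cauchy complete category $\mathbb{A}$. Assume that $\delta=\lambda\cdot He$ and that $e:1\to H$ is a (componentwise) monomorphism. Then the following are equivalent: (a) the functor $K_e:\mathbb{A}\to\mathbb{A}^{\overline{\mathcal{H}}}_{\underline{\mathcal{H}}}(\lambda)$, $a\mapsto(H(a),m_a,\delta_a)$, is an equivalence of categories; (b) for every $(a,h)\in\mathbb{A}_{\underline{\mathcal{H}}}$ the composite $H(a)\xrightarrow{\delta_a}HH(a)\xrightarrow{H(h)}H(a)$ is an isomorphism; (c) the composite $HH\xrightarrow{\delta H}HHH\xrightarrow{Hm}HH$ is an isomorphism. If these equivalent conditions hold and, in addition, $\varepsilon:H\to1$ is an augmentation of the monad $\underline{\mathcal{H}}$, then $(\underline{\mathcal{H}},\overline{\mathcal{H}},\lambda)$ is a Hopf monad.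
   Context: Composition of functors is written by juxtaposition and composition of natural transformations by $\cdot$. A category is Cauchy complete if all idempotents in it split. A monad-comonad triple on $\mathbb{A}$ consists of a monad $\underline{\mathcal{H}}=(H,m,e)$ and a comonad $\overline{\mathcal{H}}=(H,\delta,\varepsilon)$ on $\mathbb{A}$ with the same underlying functor $H$, and an entwining $\lambda:HH\to HH$ from $\underline{\mathcal{H}}$ to $\overline{\mathcal{H}}$, i.e. a natural transformation with $$\lambda\cdot mH=Hm\cdot\lambda H\cdot H\lambda,\quad \delta H\cdot\lambda=H\lambda\cdot\lambda H\cdot H\delta,\quad \lambda\cdot eH=He,\quad \varepsilon H\cdot\lambda=H\varepsilon.$$ $\mathbb{A}_{\underline{\mathcal{H}}}$ is the Eilenberg–Moore category of $\underline{\mathcal{H}}$-modules (algebras) $(a,h:H(a)\to a)$. A $\lambda$-bimodule is a triple $(a,h,\theta)$ with $(a,h)$ an $\underline{\mathcal{H}}$-module, $(a,\theta:a\to H(a))$ an $\overline{\mathcal{H}}$-comodule (Eilenberg–Moore coalgebra) and $\theta\cdot h=H(h)\cdot\lambda_a\cdot H(\theta)$; morphisms are morphisms in $\mathbb{A}$ that are both module and comodule morphisms. The category of $\lambda$-bimodules is $\mathbb{A}^{\overline{\mathcal{H}}}_{\underline{\mathcal{H}}}(\lambda)$. When $\delta=\lambda\cdot He$, each $(H(a),m_a,\delta_a)$ is a $\lambda$-bimodule, and $K_e(f)=H(f)$ on morphisms. The triple is compatible if $\delta\cdot m=Hm\cdot\lambda H\cdot H\delta$. It is a bimonad if it is compatible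 and $\varepsilon\cdot m=\varepsilon\cdot H\varepsilon$, $\delta\cdot e=He\cdot e$, $\varepsilon\cdot e=1$. A Hopf monad is a bimonad with an antipode, i.e. a natural transformation $S:H\to H$ with $m\cdot HS\cdot\delta=e\cdot\varepsilon=m\cdot SH\cdot\delta$. $\varepsilon$ is an augmentation of $\underline{\mathcal{H}}$ if it is a monad morphism from $\underline{\mathcal{H}}$ to the identity monad, i.e. $\varepsilon\cdot m=\varepsilon\cdot H\varepsilon$ and $\varepsilon\cdot e=1$. *)

theory Defs
  imports Main
begin

section \<open>Categories, functors, natural transformations\<close>

text \<open>
  Every arrow carries its domain and codomain. Outside \<open>Obj\<close> and \<open>Arr\<close> (and for pairs of arrows
  that are not composable) the operations are unspecified.
  The composite \<open>g \<cdot> f\<close> is ``first \<open>f\<close>, then \<open>g\<close>''.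
\<close>

record ('o, 'm) cat =
  Obj  :: "'o set"
  Arr  :: "'m set"
  Dom  :: "'m \<Rightarrow> 'o"
  Cod  :: "'m \<Rightarrow> 'o"
  Id   :: "'o \<Rightarrow> 'm"
  Comp :: "'m \<Rightarrow> 'm \<Rightarrow> 'm"  (infixl "\<cdot>\<index>" 70)

definition hom :: "('o, 'm) cat \<Rightarrow> 'o \<Rightarrow> 'o \<Rightarrow> 'm set" where
  "hom C a b = {f \<in> Arr C. Dom C f = a \<and> Cod C f = b}"

locale category =
  fixes C :: "('o, 'm) cat" (structure)
  assumes dom_obj: "f \<in> Arr C \<Longrightarrow> Dom C f \<in> Obj C"
    and cod_obj: "f \<in> Arr C \<Longrightarrow> Cod C f \<in> Obj C"
    and id_hom: "a \<in> Obj C \<Longrightarrow> Id C a \<in> hom C a a"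
    and comp_hom: "f \<in> hom C a b \<Longrightarrow> g \<in> hom C b c \<Longrightarrow> g \<cdot> f \<in> hom C a c"
    and id_left: "f \<in> hom C a b \<Longrightarrow> Id C b \<cdot> f = f"
    and id_right: "f \<in> hom C a b \<Longrightarrow> f \<cdot> Id C a = f"
    and assoc: "f \<in> hom C a b \<Longrightarrow> g \<in> hom C b c \<Longrightarrow> h \<in> hom C c d \<Longrightarrow> h \<cdot> g \<cdot> f = h \<cdot> (g \<cdot> f)"

definition is_iso :: "('o, 'm) cat \<Rightarrow> 'm \<Rightarrow> bool" where
  "is_iso C f \<longleftrightarrow> f \<in> Arr C \<and>
     (\<exists>g \<in> hom C (Cod C f) (Dom C f).
        g \<cdot>\<^bsub>C\<^esub> f = Id C (Dom C f) \<and> f \<cdot>\<^bsub>C\<^esub> g = Id C (Cod C f))"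

definition is_mono :: "('o, 'm) cat \<Rightarrow> 'm \<Rightarrow> bool" where
  "is_mono C f \<longleftrightarrow> f \<in> Arr C \<and>
     (\<forall>x \<in> Obj C. \<forall>g \<in> hom C x (Dom C f). \<forall>h \<in> hom C x (Dom C f).
        f \<cdot>\<^bsub>C\<^esub> g = f \<cdot>\<^bsub>C\<^esub> h \<longrightarrow> g = h)"

definition cauchy_complete :: "('o, 'm) cat \<Rightarrow> bool" where
  "cauchy_complete C \<longleftrightarrow> category C \<and>
     (\<forall>a \<in> Obj C. \<forall>p \<in> hom C a a. p \<cdot>\<^bsub>C\<^esub> p = p \<longrightarrow>
        (\<exists>b \<in> Obj C. \<exists>r \<in> hom C a b. \<exists>s \<in> hom C b a. s \<cdot>\<^bsub>C\<^esub> r = p \<and> r \<cdot>\<^bsub>C\<^esub> s = Id C b))"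

record ('o, 'm, 'p, 'n) ftr =
  ob :: "'o \<Rightarrow> 'p"
  ar :: "'m \<Rightarrow> 'n"

locale cat_functor = A: category A + B: category B
  for A :: "('o, 'm) cat" and B :: "('p, 'n) cat" +
  fixes F :: "('o, 'm, 'p, 'n) ftr"
  assumes ob_obj: "a \<in> Obj A \<Longrightarrow> ob F a \<in> Obj B"
    and ar_hom: "f \<in> hom A a b \<Longrightarrow> ar F f \<in> hom B (ob F a) (ob F b)"
    and ar_id: "a \<in> Obj A \<Longrightarrow> ar F (Id A a) = Id B (ob F a)"
    and ar_comp: "f \<in> hom A a b \<Longrightarrow> g \<in> hom A b c \<Longrightarrow> ar F (g \<cdot>\<^bsub>A\<^esub> f) = ar F g \<cdot>\<^bsub>B\<^esub> ar F f"

definition id_ftr :: "('o, 'm, 'o, 'm) ftr" where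
  "id_ftr = \<lparr>ob = (\<lambda>a. a), ar = (\<lambda>f. f)\<rparr>"

definition comp_ftr :: "('p, 'n, 'q, 'k) ftr \<Rightarrow> ('o, 'm, 'p, 'n) ftr \<Rightarrow> ('o, 'm, 'q, 'k) ftr"
    (infixl "\<cdot>\<cdot>" 75) where
  "G \<cdot>\<cdot> F = \<lparr>ob = (\<lambda>a. ob G (ob F a)), ar = (\<lambda>f. ar G (ar F f))\<rparr>"

text \<open>
  A natural transformation is its family of components. Equations between natural transformations
  are written out at each object \<open>a\<close>: \<open>F \<tau>\<close> has components \<open>ar F (\<tau> a)\<close> and \<open>\<tau> F\<close> has components
  \<open>\<tau> (ob F a)\<close>.
\<close>

locale nat_trans = F: cat_functor A B F + G: cat_functor A B G
  for A :: "('o, 'm) cat" and B :: "('p, 'n) cat"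
    and F :: "('o, 'm, 'p, 'n) ftr" and G :: "('o, 'm, 'p, 'n) ftr" +
  fixes \<tau> :: "'o \<Rightarrow> 'n"
  assumes component: "a \<in> Obj A \<Longrightarrow> \<tau> a \<in> hom B (ob F a) (ob G a)"
    and natural: "f \<in> hom A a b \<Longrightarrow> ar G f \<cdot>\<^bsub>B\<^esub> \<tau> a = \<tau> b \<cdot>\<^bsub>B\<^esub> ar F f"

definition nat_iso ::
    "('o, 'm) cat \<Rightarrow> ('p, 'n) cat \<Rightarrow> ('o, 'm, 'p, 'n) ftr \<Rightarrow> ('o, 'm, 'p, 'n) ftr \<Rightarrow> ('o \<Rightarrow> 'n) \<Rightarrow> bool" where
  "nat_iso A B F G \<tau> \<longleftrightarrow> nat_trans A B F G \<tau> \<and>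
     (\<exists>\<sigma>. nat_trans A B G F \<sigma> \<and>
        (\<forall>a \<in> Obj A. \<sigma> a \<cdot>\<^bsub>B\<^esub> \<tau> a = Id B (ob F a) \<and> \<tau> a \<cdot>\<^bsub>B\<^esub> \<sigma> a = Id B (ob G a)))"

definition is_equivalence ::
    "('o, 'm) cat \<Rightarrow> ('p, 'n) cat \<Rightarrow> ('o, 'm, 'p, 'n) ftr \<Rightarrow> bool" where
  "is_equivalence A B F \<longleftrightarrow> cat_functor A B F \<and>
     (\<exists>G. cat_functor B A G \<and>
        (\<exists>\<eta>. nat_iso A A id_ftr (G \<cdot>\<cdot> F) \<eta>) \<and> (\<exists>\<kappa>. nat_iso B B (F \<cdot>\<cdot> G) id_ftr \<kappa>))"


section \<open>Monads, comonads and entwinings\<close>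

locale monad = H: cat_functor A A H
    + m: nat_trans A A "H \<cdot>\<cdot> H" H m + e: nat_trans A A id_ftr H e
  for A :: "('o, 'm) cat" and H :: "('o, 'm, 'o, 'm) ftr" and m e :: "'o \<Rightarrow> 'm" +
  assumes m_assoc: "a \<in> Obj A \<Longrightarrow> m a \<cdot>\<^bsub>A\<^esub> ar H (m a) = m a \<cdot>\<^bsub>A\<^esub> m (ob H a)"
    and m_unit_left: "a \<in> Obj A \<Longrightarrow> m a \<cdot>\<^bsub>A\<^esub> e (ob H a) = Id A (ob H a)"
    and m_unit_right: "a \<in> Obj A \<Longrightarrow> m a \<cdot>\<^bsub>A\<^esub> ar H (e a) = Id A (ob H a)"

locale comonad = H: cat_functor A A H
    + \<delta>: nat_trans A A H "H \<cdot>\<cdot> H" \<delta> + \<epsilon>: nat_trans A A H id_ftr \<epsilon>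
  for A :: "('o, 'm) cat" and H :: "('o, 'm, 'o, 'm) ftr" and \<delta> \<epsilon> :: "'o \<Rightarrow> 'm" +
  assumes \<delta>_coassoc: "a \<in> Obj A \<Longrightarrow> ar H (\<delta> a) \<cdot>\<^bsub>A\<^esub> \<delta> a = \<delta> (ob H a) \<cdot>\<^bsub>A\<^esub> \<delta> a"
    and \<delta>_counit_left: "a \<in> Obj A \<Longrightarrow> \<epsilon> (ob H a) \<cdot>\<^bsub>A\<^esub> \<delta> a = Id A (ob H a)"
    and \<delta>_counit_right: "a \<in> Obj A \<Longrightarrow> ar H (\<epsilon> a) \<cdot>\<^bsub>A\<^esub> \<delta> a = Id A (ob H a)"

text \<open>In \<open>monad_comonad_triple A H m e \<delta> \<epsilon> l\<close>, the last argument \<open>l\<close> is the entwining \<open>\<lambda>\<close>.\<close>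

locale monad_comonad_triple = monad A H m e + comonad A H \<delta> \<epsilon>
    + l: nat_trans A A "H \<cdot>\<cdot> H" "H \<cdot>\<cdot> H" l
  for A :: "('o, 'm) cat" and H :: "('o, 'm, 'o, 'm) ftr" and m e \<delta> \<epsilon> l :: "'o \<Rightarrow> 'm" +
  assumes entwine_m: "a \<in> Obj A \<Longrightarrow>
        l a \<cdot>\<^bsub>A\<^esub> m (ob H a) = ar H (m a) \<cdot>\<^bsub>A\<^esub> l (ob H a) \<cdot>\<^bsub>A\<^esub> ar H (l a)"
    and entwine_\<delta>: "a \<in> Obj A \<Longrightarrow>
        \<delta> (ob H a) \<cdot>\<^bsub>A\<^esub> l a = ar H (l a) \<cdot>\<^bsub>A\<^esub> l (ob H a) \<cdot>\<^bsub>A\<^esub> ar H (\<delta> a)"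
    and entwine_e: "a \<in> Obj A \<Longrightarrow> l a \<cdot>\<^bsub>A\<^esub> e (ob H a) = ar H (e a)"
    and entwine_\<epsilon>: "a \<in> Obj A \<Longrightarrow> \<epsilon> (ob H a) \<cdot>\<^bsub>A\<^esub> l a = ar H (\<epsilon> a)"

definition is_augmentation ::
    "('o, 'm) cat \<Rightarrow> ('o, 'm, 'o, 'm) ftr \<Rightarrow> ('o \<Rightarrow> 'm) \<Rightarrow> ('o \<Rightarrow> 'm) \<Rightarrow> ('o \<Rightarrow> 'm) \<Rightarrow> bool" where
  "is_augmentation A H m e \<epsilon> \<longleftrightarrow> nat_trans A A H id_ftr \<epsilon> \<and>
     (\<forall>a \<in> Obj A. \<epsilon> a \<cdot>\<^bsub>A\<^esub> m a = \<epsilon> a \<cdot>\<^bsub>A\<^esub> ar H (\<epsilon> a) \<and> \<epsilon> a \<cdot>\<^bsub>A\<^esub> e a = Id A a)"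

locale compatible_triple = monad_comonad_triple +
  assumes compatible: "a \<in> Obj A \<Longrightarrow>
        \<delta> a \<cdot>\<^bsub>A\<^esub> m a = ar H (m a) \<cdot>\<^bsub>A\<^esub> l (ob H a) \<cdot>\<^bsub>A\<^esub> ar H (\<delta> a)"

locale bimonad = compatible_triple +
  assumes \<epsilon>_m: "a \<in> Obj A \<Longrightarrow> \<epsilon> a \<cdot>\<^bsub>A\<^esub> m a = \<epsilon> a \<cdot>\<^bsub>A\<^esub> ar H (\<epsilon> a)"
    and \<delta>_e: "a \<in> Obj A \<Longrightarrow> \<delta> a \<cdot>\<^bsub>A\<^esub> e a = ar H (e a) \<cdot>\<^bsub>A\<^esub> e a"
    and \<epsilon>_e: "a \<in> Obj A \<Longrightarrow> \<epsilon> a \<cdot>\<^bsub>A\<^esub> e a = Id A a"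

definition is_antipode ::
    "('o, 'm) cat \<Rightarrow> ('o, 'm, 'o, 'm) ftr \<Rightarrow> ('o \<Rightarrow> 'm) \<Rightarrow> ('o \<Rightarrow> 'm) \<Rightarrow> ('o \<Rightarrow> 'm) \<Rightarrow> ('o \<Rightarrow> 'm)
      \<Rightarrow> ('o \<Rightarrow> 'm) \<Rightarrow> bool" where
  "is_antipode A H m e \<delta> \<epsilon> S \<longleftrightarrow> nat_trans A A H H S \<and>
     (\<forall>a \<in> Obj A. m a \<cdot>\<^bsub>A\<^esub> ar H (S a) \<cdot>\<^bsub>A\<^esub> \<delta> a = e a \<cdot>\<^bsub>A\<^esub> \<epsilon> a \<and>
                  m a \<cdot>\<^bsub>A\<^esub> S (ob H a) \<cdot>\<^bsub>A\<^esub> \<delta> a = e a \<cdot>\<^bsub>A\<^esub> \<epsilon> a)"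

locale hopf_monad = bimonad +
  assumes antipode: "\<exists>S. is_antipode A H m e \<delta> \<epsilon> S"


section \<open>Modules, comodules and bimodules\<close>

definition modules :: "('o, 'm) cat \<Rightarrow> ('o, 'm, 'o, 'm) ftr \<Rightarrow> ('o \<Rightarrow> 'm) \<Rightarrow> ('o \<Rightarrow> 'm) \<Rightarrow> ('o \<times> 'm) set" where
  "modules A H m e = {(a, h). a \<in> Obj A \<and> h \<in> hom A (ob H a) a \<and>
     h \<cdot>\<^bsub>A\<^esub> ar H h = h \<cdot>\<^bsub>A\<^esub> m a \<and> h \<cdot>\<^bsub>A\<^esub> e a = Id A a}"

definition comodules :: "('o, 'm) cat \<Rightarrow> ('o, 'm, 'o, 'm) ftr \<Rightarrow> ('o \<Rightarrow> 'm) \<Rightarrow> ('o \<Rightarrow> 'm) \<Rightarrow> ('o \<times> 'm) set" where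
  "comodules A H \<delta> \<epsilon> = {(a, \<theta>). a \<in> Obj A \<and> \<theta> \<in> hom A a (ob H a) \<and>
     ar H \<theta> \<cdot>\<^bsub>A\<^esub> \<theta> = \<delta> a \<cdot>\<^bsub>A\<^esub> \<theta> \<and> \<epsilon> a \<cdot>\<^bsub>A\<^esub> \<theta> = Id A a}"

definition module_hom :: "('o, 'm) cat \<Rightarrow> ('o, 'm, 'o, 'm) ftr \<Rightarrow> 'o \<times> 'm \<Rightarrow> 'o \<times> 'm \<Rightarrow> 'm set" where
  "module_hom A H = (\<lambda>(a, h) (b, k). {f \<in> hom A a b. f \<cdot>\<^bsub>A\<^esub> h = k \<cdot>\<^bsub>A\<^esub> ar H f})"

definition comodule_hom :: "('o, 'm) cat \<Rightarrow> ('o, 'm, 'o, 'm) ftr \<Rightarrow> 'o \<times> 'm \<Rightarrow> 'o \<times> 'm \<Rightarrow> 'm set" where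
  "comodule_hom A H = (\<lambda>(a, \<theta>) (b, \<zeta>). {f \<in> hom A a b. \<zeta> \<cdot>\<^bsub>A\<^esub> f = ar H f \<cdot>\<^bsub>A\<^esub> \<theta>})"

type_synonym ('o, 'm) bimod = "'o \<times> 'm \<times> 'm"

definition bimodules ::
    "('o, 'm) cat \<Rightarrow> ('o, 'm, 'o, 'm) ftr \<Rightarrow> ('o \<Rightarrow> 'm) \<Rightarrow> ('o \<Rightarrow> 'm) \<Rightarrow> ('o \<Rightarrow> 'm) \<Rightarrow> ('o \<Rightarrow> 'm)
      \<Rightarrow> ('o \<Rightarrow> 'm) \<Rightarrow> ('o, 'm) bimod set" where
  "bimodules A H m e \<delta> \<epsilon> l = {(a, h, \<theta>). (a, h) \<in> modules A H m e \<and> (a, \<theta>) \<in> comodules A H \<delta> \<epsilon> \<and>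
     \<theta> \<cdot>\<^bsub>A\<^esub> h = ar H h \<cdot>\<^bsub>A\<^esub> l a \<cdot>\<^bsub>A\<^esub> ar H \<theta>}"

text \<open>
  An arrow of the category of bimodules is a triple \<open>(x, y, f)\<close>, where \<open>f\<close> is the underlying
  arrow in \<open>A\<close> and \<open>x\<close>, \<open>y\<close> are its domain and codomain.
\<close>

definition bimod_cat ::
    "('o, 'm) cat \<Rightarrow> ('o, 'm, 'o, 'm) ftr \<Rightarrow> ('o \<Rightarrow> 'm) \<Rightarrow> ('o \<Rightarrow> 'm) \<Rightarrow> ('o \<Rightarrow> 'm) \<Rightarrow> ('o \<Rightarrow> 'm)
      \<Rightarrow> ('o \<Rightarrow> 'm) \<Rightarrow> (('o, 'm) bimod, ('o, 'm) bimod \<times> ('o, 'm) bimod \<times> 'm) cat" where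
  "bimod_cat A H m e \<delta> \<epsilon> l =
     \<lparr>Obj = bimodules A H m e \<delta> \<epsilon> l,
      Arr = {((a, h, \<theta>), (b, k, \<zeta>), f).
               (a, h, \<theta>) \<in> bimodules A H m e \<delta> \<epsilon> l \<and> (b, k, \<zeta>) \<in> bimodules A H m e \<delta> \<epsilon> l \<and>
               f \<in> module_hom A H (a, h) (b, k) \<and> f \<in> comodule_hom A H (a, \<theta>) (b, \<zeta>)},
      Dom = (\<lambda>(x, y, f). x),
      Cod = (\<lambda>(x, y, f). y),
      Id = (\<lambda>(a, h, \<theta>). ((a, h, \<theta>), (a, h, \<theta>), Id A a)),
      Comp = (\<lambda>(y', z, g) (x, y, f). (x, z, g \<cdot>\<^bsub>A\<^esub> f))\<rparr>"

definition K_e ::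
    "('o, 'm) cat \<Rightarrow> ('o, 'm, 'o, 'm) ftr \<Rightarrow> ('o \<Rightarrow> 'm) \<Rightarrow> ('o \<Rightarrow> 'm)
      \<Rightarrow> ('o, 'm, ('o, 'm) bimod, ('o, 'm) bimod \<times> ('o, 'm) bimod \<times> 'm) ftr" where
  "K_e A H m \<delta> =
     \<lparr>ob = (\<lambda>a. (ob H a, m a, \<delta> a)),
      ar = (\<lambda>f. ((ob H (Dom A f), m (Dom A f), \<delta> (Dom A f)),
                 (ob H (Cod A f), m (Cod A f), \<delta> (Cod A f)), ar H f))\<rparr>"

end

(*
  For a module (a, h) put t = H h . delta_a : H a -> H a. These maps are the components of the
  comonad morphism from the comonad on modules induced by the free-forgetful adjunction to the lifting
  of the comonad H, whose coalgebras are the bimodules. From delta = lambda . He one gets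
  delta . e = He . e, hence e . eps . e = e and eps . e = 1 because e is a monomorphism.

  If K_e is an equivalence, then the cofree bimodule on (a, h) is isomorphic to some K_e b, and
  maps from free to cofree bimodules factor through t, which makes t invertible. Conversely, if all
  t are invertible, then a bimodule structure is the same as a coalgebra structure for the induced
  comonad, and the splitting eps of e together with split idempotents gives the required object b.
  Finally t on free modules determines t on all modules, because every module is a split
  coequalizer of free ones in the base category.
*)

theory Submission
  imports Defs
begin

section \<open>Composition in categories and equivalences\<close>

context category
begin

lemma hom_iff: "f \<in> hom C a b \<longleftrightarrow> f \<in> Arr C \<and> Dom C f = a \<and> Cod C f = b"
  by (auto simp: hom_def)

lemma Dom_Obj [simp]: "f \<in> Arr C \<Longrightarrow> Dom C f \<in> Obj C"
  and Cod_Obj [simp]: "f \<in> Arr C \<Longrightarrow> Cod C f \<in> Obj C"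
  by (auto intro: dom_obj cod_obj)

lemma Id_arr [simp]:
  assumes "a \<in> Obj C"
  shows "Id C a \<in> Arr C" "Dom C (Id C a) = a" "Cod C (Id C a) = a"
  using id_hom[OF assms] by (auto simp: hom_iff)

lemma comp_arr [simp]:
  assumes "f \<in> Arr C" "g \<in> Arr C" "Dom C g = Cod C f"
  shows "g \<cdot> f \<in> Arr C" "Dom C (g \<cdot> f) = Dom C f" "Cod C (g \<cdot> f) = Cod C g"
  using comp_hom[of f "Dom C f" "Cod C f" g "Cod C g"] assms by (auto simp: hom_iff)

lemma comp_Id [simp]:
  "f \<in> Arr C \<Longrightarrow> Cod C f = b \<Longrightarrow> Id C b \<cdot> f = f"
  "f \<in> Arr C \<Longrightarrow> Dom C f = a \<Longrightarrow> f \<cdot> Id C a = f"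
  by (auto intro: id_left id_right simp: hom_iff)

lemma comp_assoc [simp]:
  assumes "f \<in> Arr C" "g \<in> Arr C" "h \<in> Arr C" "Dom C g = Cod C f" "Dom C h = Cod C g"
  shows "h \<cdot> g \<cdot> f = h \<cdot> (g \<cdot> f)"
  using assoc[of f "Dom C f" "Cod C f" g "Cod C g" h "Cod C h"] assms by (auto simp: hom_iff)

text \<open>Simplification nests composites to the right, so an equation between two-factor
  composites no longer matches inside a longer chain. Whiskering restores the match by letting both
  sides act on a tail \<open>x\<close>; the two variants below treat a right-hand side that is an
  identity or a single arrow.\<close>

lemma whisker:
  assumes "g \<cdot> f = k \<cdot> j"
    and "f \<in> Arr C" "g \<in> Arr C" "j \<in> Arr C" "k \<in> Arr C" "x \<in> Arr C"
    and "Dom C g = Cod C f" "Dom C k = Cod C j" "Dom C f = Cod C x" "Dom C j = Cod C x"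
  shows "g \<cdot> (f \<cdot> x) = k \<cdot> (j \<cdot> x)"
  using assms by (metis comp_assoc)

lemma whisker_Id:
  assumes "g \<cdot> f = Id C a"
    and "f \<in> Arr C" "g \<in> Arr C" "x \<in> Arr C"
    and "Dom C g = Cod C f" "Dom C f = Cod C x" "Cod C x = a"
  shows "g \<cdot> (f \<cdot> x) = x"
  using assms by (metis comp_assoc comp_Id(1))

lemma whisker_single:
  assumes "g \<cdot> f = k"
    and "f \<in> Arr C" "g \<in> Arr C" "x \<in> Arr C"
    and "Dom C g = Cod C f" "Dom C f = Cod C x"
  shows "g \<cdot> (f \<cdot> x) = k \<cdot> x"
  using assms by (metis comp_assoc)

lemma is_isoI:
  assumes "f \<in> Arr C" "g \<in> Arr C" "Dom C g = Cod C f" "Cod C g = Dom C f"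
    and "g \<cdot> f = Id C (Dom C f)" "f \<cdot> g = Id C (Cod C f)"
  shows "is_iso C f"
  unfolding is_iso_def using assms by (intro conjI bexI[of _ g]) (simp_all add: hom_iff)

lemma is_isoE:
  assumes "is_iso C f"
  obtains g where "g \<in> Arr C" "Dom C g = Cod C f" "Cod C g = Dom C f"
    "g \<cdot> f = Id C (Dom C f)" "f \<cdot> g = Id C (Cod C f)"
proof -
  obtain g where "g \<in> hom C (Cod C f) (Dom C f)"
    "g \<cdot> f = Id C (Dom C f)" "f \<cdot> g = Id C (Cod C f)"
    using assms unfolding is_iso_def by blast
  then show ?thesis by (intro that[of g]) (simp_all add: hom_iff)
qed

lemma iso_cancel_left:
  assumes "is_iso C f" "f \<cdot> x = f \<cdot> y" "x \<in> Arr C" "y \<in> Arr C"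
    and "Dom C f = Cod C x" "Dom C f = Cod C y"
  shows "x = y"
proof -
  have f: "f \<in> Arr C" using assms(1) by (simp add: is_iso_def)
  obtain g where g: "g \<in> Arr C" "Dom C g = Cod C f" "g \<cdot> f = Id C (Dom C f)"
    using assms(1) by (rule is_isoE)
  have "g \<cdot> (f \<cdot> x) = x"
    by (rule whisker_Id[OF g(3) f g(1) assms(3) g(2) assms(5) assms(5)[symmetric]])
  moreover have "g \<cdot> (f \<cdot> y) = y"
    by (rule whisker_Id[OF g(3) f g(1) assms(4) g(2) assms(6) assms(6)[symmetric]])
  ultimately show ?thesis using assms(2) by metis
qed

text \<open>Commuting squares pass to inverses: insert \<open>s \<cdot> s'\<close> to the right of
  \<open>v\<close>, use the square, and cancel \<open>t' \<cdot> t\<close>.\<close>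

lemma inverse_square:
  assumes "v \<cdot> s = t \<cdot> u" "s \<cdot> s' = Id C (Dom C v)" "t' \<cdot> t = Id C (Cod C u)"
    and "v \<in> Arr C" "s \<in> Arr C" "t \<in> Arr C" "u \<in> Arr C" "s' \<in> Arr C" "t' \<in> Arr C"
    and "Cod C s = Dom C v" "Cod C s' = Dom C s" "Dom C s' = Cod C s"
    and "Cod C u = Dom C t" "Cod C t' = Dom C t" "Dom C t' = Cod C t"
    and "Dom C u = Dom C s" "Cod C v = Cod C t"
  shows "t' \<cdot> v = u \<cdot> s'"
proof -
  have "t' \<cdot> v = t' \<cdot> (v \<cdot> (s \<cdot> s'))" unfolding assms(2) using assms(4) by simp
  also have "v \<cdot> (s \<cdot> s') = t \<cdot> (u \<cdot> s')" by (rule whisker) (use assms in simp_all)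
  also have "t' \<cdot> \<dots> = u \<cdot> s'" by (rule whisker_Id) (use assms(3-) in simp_all)
  finally show ?thesis .
qed

lemma id_functor: "cat_functor C C id_ftr"
  by unfold_locales (auto simp: id_ftr_def)

end

section \<open>Functors and natural transformations\<close>

context cat_functor
begin

lemma ob_Obj [simp]: "a \<in> Obj A \<Longrightarrow> ob F a \<in> Obj B"
  by (rule ob_obj)

lemma ar_arr [simp]:
  assumes "f \<in> Arr A"
  shows "ar F f \<in> Arr B" "Dom B (ar F f) = ob F (Dom A f)" "Cod B (ar F f) = ob F (Cod A f)"
  using ar_hom[of f "Dom A f" "Cod A f"] assms by (auto simp: A.hom_iff B.hom_iff)

lemma ar_Id [simp]: "a \<in> Obj A \<Longrightarrow> ar F (Id A a) = Id B (ob F a)"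
  by (rule ar_id)

lemma ar_Comp [simp]:
  assumes "f \<in> Arr A" "g \<in> Arr A" "Dom A g = Cod A f"
  shows "ar F (g \<cdot>\<^bsub>A\<^esub> f) = ar F g \<cdot>\<^bsub>B\<^esub> ar F f"
  using ar_comp[of f "Dom A f" "Cod A f" g "Cod A g"] assms by (auto simp: A.hom_iff)

lemma ar_iso:
  assumes "is_iso A f"
  shows "is_iso B (ar F f)"
proof -
  have f: "f \<in> Arr A" using assms by (simp add: is_iso_def)
  obtain g where g: "g \<in> Arr A" "Dom A g = Cod A f" "Cod A g = Dom A f"
    "g \<cdot>\<^bsub>A\<^esub> f = Id A (Dom A f)" "f \<cdot>\<^bsub>A\<^esub> g = Id A (Cod A f)"
    using assms by (rule A.is_isoE)
  show ?thesis
    by (rule B.is_isoI[where g = "ar F g"])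
      (use f g ar_Comp[of f g] ar_Comp[of g f] in simp_all)
qed

end

lemma functor_comp:
  assumes "cat_functor A B F" "cat_functor B C G"
  shows "cat_functor A C (G \<cdot>\<cdot> F)"
proof -
  interpret F: cat_functor A B F by fact
  interpret G: cat_functor B C G by fact
  show ?thesis
    by unfold_locales (auto simp: comp_ftr_def F.A.hom_iff G.B.hom_iff)
qed

lemma nat_transI:
  assumes "cat_functor A B F" "cat_functor A B G"
    and "\<And>a. a \<in> Obj A \<Longrightarrow> \<tau> a \<in> Arr B \<and> Dom B (\<tau> a) = ob F a \<and> Cod B (\<tau> a) = ob G a"
    and "\<And>f. f \<in> Arr A \<Longrightarrow> ar G f \<cdot>\<^bsub>B\<^esub> \<tau> (Dom A f) = \<tau> (Cod A f) \<cdot>\<^bsub>B\<^esub> ar F f"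
  shows "nat_trans A B F G \<tau>"
proof -
  interpret F: cat_functor A B F by fact
  interpret G: cat_functor A B G by fact
  show ?thesis
    by unfold_locales (use assms(3,4) in \<open>auto simp: F.A.hom_iff F.B.hom_iff\<close>)
qed

lemma (in nat_trans) component_arr:
  assumes "a \<in> Obj A"
  shows "\<tau> a \<in> Arr B" "Dom B (\<tau> a) = ob F a" "Cod B (\<tau> a) = ob G a"
  using component[OF assms] by (auto simp: F.B.hom_iff)

lemma (in nat_trans) naturality:
  "f \<in> Arr A \<Longrightarrow> ar G f \<cdot>\<^bsub>B\<^esub> \<tau> (Dom A f) = \<tau> (Cod A f) \<cdot>\<^bsub>B\<^esub> ar F f"
  by (rule natural) (auto simp: F.A.hom_iff)

text \<open>Componentwise inverses are automatically natural, so invertibility may be tested object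
  by object.\<close>

lemma nat_iso_iff:
  "nat_iso A B F G \<tau> \<longleftrightarrow> nat_trans A B F G \<tau> \<and> (\<forall>a \<in> Obj A. is_iso B (\<tau> a))"
proof
  assume iso: "nat_iso A B F G \<tau>"
  then obtain \<sigma> where \<sigma>: "nat_trans A B G F \<sigma>"
    "\<And>a. a \<in> Obj A \<Longrightarrow> \<sigma> a \<cdot>\<^bsub>B\<^esub> \<tau> a = Id B (ob F a) \<and> \<tau> a \<cdot>\<^bsub>B\<^esub> \<sigma> a = Id B (ob G a)"
    unfolding nat_iso_def by blast
  interpret t: nat_trans A B F G \<tau> using iso by (simp add: nat_iso_def)
  interpret s: nat_trans A B G F \<sigma> by fact
  have "is_iso B (\<tau> a)" if "a \<in> Obj A" for a
    by (rule t.F.B.is_isoI[where g = "\<sigma> a"])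
      (use that \<sigma>(2) in \<open>simp_all add: t.component_arr s.component_arr\<close>)
  then show "nat_trans A B F G \<tau> \<and> (\<forall>a \<in> Obj A. is_iso B (\<tau> a))"
    using t.nat_trans_axioms by blast
next
  assume r: "nat_trans A B F G \<tau> \<and> (\<forall>a \<in> Obj A. is_iso B (\<tau> a))"
  then interpret t: nat_trans A B F G \<tau> by blast
  \<comment> \<open>The condition \<open>a \<in> Obj A\<close> sits inside the existential, since
    the chosen inverses must form a function on the whole type.\<close>
  have "\<forall>a. \<exists>g. a \<in> Obj A \<longrightarrow> g \<in> Arr B \<and> Dom B g = Cod B (\<tau> a) \<and> Cod B g = Dom B (\<tau> a) \<and>
      g \<cdot>\<^bsub>B\<^esub> \<tau> a = Id B (Dom B (\<tau> a)) \<and> \<tau> a \<cdot>\<^bsub>B\<^esub> g = Id B (Cod B (\<tau> a))"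
    using r by (meson t.F.B.is_isoE)
  then obtain \<sigma> where \<sigma>: "\<And>a. a \<in> Obj A \<Longrightarrow> \<sigma> a \<in> Arr B \<and> Dom B (\<sigma> a) = Cod B (\<tau> a) \<and>
      Cod B (\<sigma> a) = Dom B (\<tau> a) \<and>
      \<sigma> a \<cdot>\<^bsub>B\<^esub> \<tau> a = Id B (Dom B (\<tau> a)) \<and> \<tau> a \<cdot>\<^bsub>B\<^esub> \<sigma> a = Id B (Cod B (\<tau> a))"
    by metis
  note [simp] = t.component_arr \<sigma>
  have "nat_trans A B G F \<sigma>"
  proof (rule nat_transI[OF t.G.cat_functor_axioms t.F.cat_functor_axioms])
    fix f assume f: "f \<in> Arr A"
    let ?a = "Dom A f" and ?b = "Cod A f"
    have *: "\<sigma> ?b \<cdot>\<^bsub>B\<^esub> \<tau> ?b = Id B (ob F ?b)" using f by simp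
    have "ar F f \<cdot>\<^bsub>B\<^esub> \<sigma> ?a = \<sigma> ?b \<cdot>\<^bsub>B\<^esub> (\<tau> ?b \<cdot>\<^bsub>B\<^esub> (ar F f \<cdot>\<^bsub>B\<^esub> \<sigma> ?a))"
      using f by (simp add: t.F.B.whisker_Id[OF *])
    also have "\<tau> ?b \<cdot>\<^bsub>B\<^esub> (ar F f \<cdot>\<^bsub>B\<^esub> \<sigma> ?a) = ar G f \<cdot>\<^bsub>B\<^esub> (\<tau> ?a \<cdot>\<^bsub>B\<^esub> \<sigma> ?a)"
      using f by (intro t.F.B.whisker[OF t.naturality[symmetric]]) simp_all
    finally show "ar F f \<cdot>\<^bsub>B\<^esub> \<sigma> ?a = \<sigma> ?b \<cdot>\<^bsub>B\<^esub> ar G f" using f by simp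
  qed simp
  then show "nat_iso A B F G \<tau>"
    unfolding nat_iso_def using t.nat_trans_axioms by (auto intro!: exI[of _ \<sigma>])
qed

text \<open>Naturality of \<eta> expresses \<open>\<eta> (Cod A f) \<cdot> f\<close> through
  \<open>ar T f\<close>, so \<open>ar T f\<close> determines \<open>f\<close> once \<eta> is
  cancelled. With \<open>T\<close> a composite of two functors, the inner one is therefore
  faithful.\<close>

lemma nat_iso_faithful:
  assumes "nat_iso A A id_ftr T \<eta>"
    and "f \<in> Arr A" "g \<in> Arr A" "Dom A f = Dom A g" "Cod A f = Cod A g" "ar T f = ar T g"
  shows "f = g"
proof -
  interpret nat_trans A A id_ftr T \<eta> using assms(1) by (simp add: nat_iso_def)
  have "\<eta> (Cod A f) \<cdot>\<^bsub>A\<^esub> f = \<eta> (Cod A f) \<cdot>\<^bsub>A\<^esub> g"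
    using naturality[OF assms(2)] naturality[OF assms(3)] assms(4-) by (simp add: id_ftr_def)
  then show ?thesis
    using assms(2-5) F.A.iso_cancel_left[of "\<eta> (Cod A f)" f g] assms(1)
    by (simp add: nat_iso_iff component_arr id_ftr_def)
qed

section \<open>Equivalences as fully faithful, essentially surjective functors\<close>

lemma nat_iso_sym:
  assumes "nat_iso A B F G \<tau>"
  shows "\<exists>\<sigma>. nat_iso A B G F \<sigma>"
  using assms unfolding nat_iso_def by blast

text \<open>The unit conjugates \<open>ar G \<psi>\<close> into an arrow \<open>f\<close> with
  \<open>ar G (ar F f) = ar G \<psi>\<close>; the isomorphism \<kappa> makes \<open>G\<close>
  faithful, which removes \<open>G\<close>.\<close>

lemma equivalence_full:
  assumes "is_equivalence A B F" "a \<in> Obj A" "b \<in> Obj A" "\<psi> \<in> hom B (ob F a) (ob F b)"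
  obtains f where "f \<in> hom A a b" "ar F f = \<psi>"
proof -
  interpret F: cat_functor A B F using assms(1) by (simp add: is_equivalence_def)
  obtain G \<eta> \<kappa> where G: "cat_functor B A G"
    and \<eta>: "nat_iso A A id_ftr (G \<cdot>\<cdot> F) \<eta>" and \<kappa>: "nat_iso B B id_ftr (F \<cdot>\<cdot> G) \<kappa>"
    using assms(1) nat_iso_sym unfolding is_equivalence_def by blast
  interpret G: cat_functor B A G by fact
  interpret \<eta>: nat_trans A A id_ftr "G \<cdot>\<cdot> F" \<eta> using \<eta> by (simp add: nat_iso_def)
  note \<psi> = assms(4)[unfolded F.B.hom_iff]
  have \<eta>a: "\<eta> x \<in> Arr A" "Dom A (\<eta> x) = x" "Cod A (\<eta> x) = ob G (ob F x)" if "x \<in> Obj A" for x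
    using \<eta>.component_arr[OF that] by (auto simp: id_ftr_def comp_ftr_def)
  have iso: "is_iso A (\<eta> x)" if "x \<in> Obj A" for x
    using \<eta> that by (simp add: nat_iso_iff)
  obtain \<eta>b where \<eta>b: "\<eta>b \<in> Arr A" "Dom A \<eta>b = ob G (ob F b)" "Cod A \<eta>b = b"
      "\<eta> b \<cdot>\<^bsub>A\<^esub> \<eta>b = Id A (ob G (ob F b))"
    using iso[OF assms(3)] \<eta>a[OF assms(3)] by (metis F.A.is_isoE)
  obtain \<eta>' where \<eta>': "\<eta>' \<in> Arr A" "Dom A \<eta>' = ob G (ob F a)" "Cod A \<eta>' = a"
      "\<eta> a \<cdot>\<^bsub>A\<^esub> \<eta>' = Id A (ob G (ob F a))"
    using iso[OF assms(2)] \<eta>a[OF assms(2)] by (metis F.A.is_isoE)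
  define f where "f = \<eta>b \<cdot>\<^bsub>A\<^esub> (ar G \<psi> \<cdot>\<^bsub>A\<^esub> \<eta> a)"
  have f: "f \<in> Arr A" "Dom A f = a" "Cod A f = b"
    using assms(2) \<psi> \<eta>a \<eta>b by (simp_all add: f_def)
  have "ar G (ar F f) \<cdot>\<^bsub>A\<^esub> \<eta> a = \<eta> b \<cdot>\<^bsub>A\<^esub> f"
    using \<eta>.naturality[OF f(1)] f by (simp add: id_ftr_def comp_ftr_def)
  also have "\<dots> = ar G \<psi> \<cdot>\<^bsub>A\<^esub> \<eta> a"
    unfolding f_def using assms(2,3) \<psi> \<eta>a \<eta>b(1-3) by (intro F.A.whisker_Id[OF \<eta>b(4)]) simp_all
  finally have "(ar G (ar F f) \<cdot>\<^bsub>A\<^esub> \<eta> a) \<cdot>\<^bsub>A\<^esub> \<eta>' = (ar G \<psi> \<cdot>\<^bsub>A\<^esub> \<eta> a) \<cdot>\<^bsub>A\<^esub> \<eta>'" by simp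
  then have "ar G (ar F f) = ar G \<psi>"
    using assms(2) \<psi> f \<eta>a \<eta>' by simp
  then have "ar F f = \<psi>"
    using nat_iso_faithful[OF \<kappa>, of "ar F f" \<psi>] \<psi> f by (simp add: comp_ftr_def)
  with f that show ?thesis by (simp add: F.A.hom_iff)
qed

lemma equivalence_eso:
  assumes "is_equivalence A B F" "b \<in> Obj B"
  obtains a f where "a \<in> Obj A" "f \<in> hom B (ob F a) b" "is_iso B f"
proof -
  obtain G \<kappa> where G: "cat_functor B A G" and \<kappa>: "nat_iso B B (F \<cdot>\<cdot> G) id_ftr \<kappa>"
    using assms(1) unfolding is_equivalence_def by blast
  interpret G: cat_functor B A G by fact
  interpret \<kappa>: nat_trans B B "F \<cdot>\<cdot> G" id_ftr \<kappa> using \<kappa> by (simp add: nat_iso_def)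
  show ?thesis
    using that[of "ob G b" "\<kappa> b"] \<kappa>.component[OF assms(2)] \<kappa> assms(2)
    by (simp add: nat_iso_iff id_ftr_def comp_ftr_def)
qed

text \<open>A quasi-inverse arises by choosing, for each \<open>b\<close>, an object
  \<open>g b\<close> and an isomorphism \<open>k b\<close> from its image to \<open>b\<close>.
  Fullness lifts arrows, and equations between lifts are checked after applying \<open>F\<close>, by
  faithfulness.\<close>

lemma (in cat_functor) equivalenceI:
  assumes faithful: "\<And>f g. f \<in> Arr A \<Longrightarrow> g \<in> Arr A \<Longrightarrow> Dom A f = Dom A g \<Longrightarrow> Cod A f = Cod A g
      \<Longrightarrow> ar F f = ar F g \<Longrightarrow> f = g"
    and full: "\<And>a b \<psi>. a \<in> Obj A \<Longrightarrow> b \<in> Obj A \<Longrightarrow> \<psi> \<in> hom B (ob F a) (ob F b)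
      \<Longrightarrow> \<exists>f \<in> hom A a b. ar F f = \<psi>"
    and eso: "\<And>b. b \<in> Obj B \<Longrightarrow> \<exists>a \<in> Obj A. \<exists>f \<in> hom B (ob F a) b. is_iso B f"
  shows "is_equivalence A B F"
proof -
  \<comment> \<open>Bundling object, isomorphism and inverse in one predicate lets a single choice
    produce three matching functions.\<close>
  define P where "P b a f f' \<longleftrightarrow> a \<in> Obj A \<and> f \<in> Arr B \<and> Dom B f = ob F a \<and> Cod B f = b \<and>
      f' \<in> Arr B \<and> Dom B f' = b \<and> Cod B f' = ob F a \<and>
      f' \<cdot>\<^bsub>B\<^esub> f = Id B (ob F a) \<and> f \<cdot>\<^bsub>B\<^esub> f' = Id B b" for b a f f'
  have "\<exists>a f f'. P b a f f'" if b: "b \<in> Obj B" for b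
  proof -
    obtain a f where a: "a \<in> Obj A" "f \<in> hom B (ob F a) b" "is_iso B f" using eso b by blast
    obtain f' where "f' \<in> Arr B" "Dom B f' = Cod B f" "Cod B f' = Dom B f"
      "f' \<cdot>\<^bsub>B\<^esub> f = Id B (Dom B f)" "f \<cdot>\<^bsub>B\<^esub> f' = Id B (Cod B f)"
      using a(3) by (rule B.is_isoE)
    with a(1,2) have "P b a f f'" unfolding P_def B.hom_iff by auto
    then show ?thesis by blast
  qed
  then obtain g k k' where gk: "\<And>b. b \<in> Obj B \<Longrightarrow> P b (g b) (k b) (k' b)" by metis
  define Q where "Q a b \<psi> f \<longleftrightarrow> f \<in> Arr A \<and> Dom A f = a \<and> Cod A f = b \<and> ar F f = \<psi>" for a b \<psi> f
  have "\<exists>f. Q a b \<psi> f" if "a \<in> Obj A" "b \<in> Obj A" "\<psi> \<in> hom B (ob F a) (ob F b)" for a b \<psi>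
    using full[OF that] by (auto simp: Q_def A.hom_iff)
  then obtain lift where "\<And>a b \<psi>. a \<in> Obj A \<Longrightarrow> b \<in> Obj A \<Longrightarrow> \<psi> \<in> hom B (ob F a) (ob F b)
      \<Longrightarrow> Q a b \<psi> (lift a b \<psi>)"
    by metis
  note gk = gk[unfolded P_def] and lift = this[unfolded Q_def B.hom_iff]
  note [simp] = gk lift
  have [simp]: "k b \<cdot>\<^bsub>B\<^esub> (k' b \<cdot>\<^bsub>B\<^esub> x) = x"
    if "x \<in> Arr B" "Cod B x = b" "b \<in> Obj B" for b x
    using that B.whisker_Id[of "k b" "k' b"] by simp
  have [simp]: "k' b \<cdot>\<^bsub>B\<^esub> (k b \<cdot>\<^bsub>B\<^esub> y) = y"
    if "y \<in> Arr B" "Cod B y = ob F (g b)" "b \<in> Obj B" for b y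
    using that B.whisker_Id[of "k' b" "k b"] by simp
  \<comment> \<open>Arrows are conjugated by the chosen isomorphisms, then lifted along
    \<open>F\<close>.\<close>
  define G where "G = \<lparr>ob = g,
    ar = (\<lambda>f. lift (g (Dom B f)) (g (Cod B f)) (k' (Cod B f) \<cdot>\<^bsub>B\<^esub> (f \<cdot>\<^bsub>B\<^esub> k (Dom B f))))\<rparr>"
  interpret G: cat_functor B A G
  proof unfold_locales
    show "ar G f \<in> hom A (ob G a) (ob G b)" if "f \<in> hom B a b" for f a b
      using that by (auto simp: G_def A.hom_iff B.hom_iff)
    show "ar G (Id B a) = Id A (ob G a)" if "a \<in> Obj B" for a
      by (rule faithful) (use that in \<open>simp_all add: G_def\<close>)
    show "ar G (f' \<cdot>\<^bsub>B\<^esub> f) = ar G f' \<cdot>\<^bsub>A\<^esub> ar G f"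
      if "f \<in> hom B a b" "f' \<in> hom B b c" for f f' a b c
      by (rule faithful) (use that in \<open>auto simp: G_def B.hom_iff\<close>)
  qed (simp add: G_def)
  \<comment> \<open>The unit is the lift of \<open>k'\<close> at \<open>ob F a\<close>; its inverse
    will be the lift of \<open>k\<close>.\<close>
  define \<eta> where "\<eta> a = lift a (g (ob F a)) (k' (ob F a))" for a
  have "nat_iso A A id_ftr (G \<cdot>\<cdot> F) \<eta>"
    unfolding nat_iso_iff
  proof (intro conjI ballI)
    show "nat_trans A A id_ftr (G \<cdot>\<cdot> F) \<eta>"
    proof (rule nat_transI[OF A.id_functor functor_comp[OF cat_functor_axioms G.cat_functor_axioms]])
      show "ar (G \<cdot>\<cdot> F) f \<cdot>\<^bsub>A\<^esub> \<eta> (Dom A f) = \<eta> (Cod A f) \<cdot>\<^bsub>A\<^esub> ar id_ftr f" if "f \<in> Arr A" for f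
        by (rule faithful) (use that in \<open>simp_all add: \<eta>_def G_def comp_ftr_def id_ftr_def\<close>)
    qed (simp add: \<eta>_def G_def comp_ftr_def id_ftr_def)
    show "is_iso A (\<eta> a)" if "a \<in> Obj A" for a
    proof (rule A.is_isoI[where g = "lift (g (ob F a)) a (k (ob F a))"])
      show "lift (g (ob F a)) a (k (ob F a)) \<cdot>\<^bsub>A\<^esub> \<eta> a = Id A (Dom A (\<eta> a))"
        by (rule faithful) (use that in \<open>simp_all add: \<eta>_def\<close>)
      show "\<eta> a \<cdot>\<^bsub>A\<^esub> lift (g (ob F a)) a (k (ob F a)) = Id A (Cod A (\<eta> a))"
        by (rule faithful) (use that in \<open>simp_all add: \<eta>_def\<close>)
    qed (use that in \<open>simp_all add: \<eta>_def\<close>)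
  qed
  moreover have "nat_iso B B (F \<cdot>\<cdot> G) id_ftr k"
    unfolding nat_iso_iff
  proof (intro conjI ballI)
    show "nat_trans B B (F \<cdot>\<cdot> G) id_ftr k"
      by (rule nat_transI[OF functor_comp[OF G.cat_functor_axioms cat_functor_axioms] B.id_functor])
        (simp_all add: G_def comp_ftr_def id_ftr_def)
    show "is_iso B (k b)" if "b \<in> Obj B" for b
      by (rule B.is_isoI[where g = "k' b"]) (use that in simp_all)
  qed
  ultimately show ?thesis
    unfolding is_equivalence_def using cat_functor_axioms G.cat_functor_axioms by blast
qed

section \<open>Entwinings with \<open>\<delta> = \<lambda> \<cdot> He\<close>\<close>

lemma comp_ftr_simps [simp]:
  "ob (G \<cdot>\<cdot> F) a = ob G (ob F a)" "ar (G \<cdot>\<cdot> F) f = ar G (ar F f)"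
  by (simp_all add: comp_ftr_def)

lemma id_ftr_simps [simp]: "ob id_ftr a = a" "ar id_ftr f = f"
  by (simp_all add: id_ftr_def)

locale unital_entwining = monad_comonad_triple A H m e \<delta> \<epsilon> l
  for A :: "('o, 'm) cat" (structure) and H m e \<delta> \<epsilon> l +
  assumes \<delta>_eq: "a \<in> Obj A \<Longrightarrow> \<delta> a = l a \<cdot> ar H (e a)"
    and mono_e: "a \<in> Obj A \<Longrightarrow> is_mono A (e a)"
begin

section \<open>Typing, naturality and unit rules for the structure maps\<close>

lemma arr_m [simp]:
  "a \<in> Obj A \<Longrightarrow> m a \<in> Arr A" "a \<in> Obj A \<Longrightarrow> Dom A (m a) = ob H (ob H a)"
  "a \<in> Obj A \<Longrightarrow> Cod A (m a) = ob H a"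
  using m.component_arr by auto

lemma arr_e [simp]:
  "a \<in> Obj A \<Longrightarrow> e a \<in> Arr A" "a \<in> Obj A \<Longrightarrow> Dom A (e a) = a"
  "a \<in> Obj A \<Longrightarrow> Cod A (e a) = ob H a"
  using e.component_arr by auto

lemma arr_\<delta> [simp]:
  "a \<in> Obj A \<Longrightarrow> \<delta> a \<in> Arr A" "a \<in> Obj A \<Longrightarrow> Dom A (\<delta> a) = ob H a"
  "a \<in> Obj A \<Longrightarrow> Cod A (\<delta> a) = ob H (ob H a)"
  using \<delta>.component_arr by auto

lemma arr_\<epsilon> [simp]:
  "a \<in> Obj A \<Longrightarrow> \<epsilon> a \<in> Arr A" "a \<in> Obj A \<Longrightarrow> Dom A (\<epsilon> a) = ob H a"
  "a \<in> Obj A \<Longrightarrow> Cod A (\<epsilon> a) = a"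
  using \<epsilon>.component_arr by auto

lemma arr_l [simp]:
  "a \<in> Obj A \<Longrightarrow> l a \<in> Arr A" "a \<in> Obj A \<Longrightarrow> Dom A (l a) = ob H (ob H a)"
  "a \<in> Obj A \<Longrightarrow> Cod A (l a) = ob H (ob H a)"
  using l.component_arr by auto

text \<open>All rules are oriented to move a structure map to the right, towards the domain. The
  codomain is a separate variable \<open>b\<close>, so that they still match after it has been
  simplified.\<close>

lemma nat_m: "f \<in> Arr A \<Longrightarrow> Cod A f = b \<Longrightarrow> m b \<cdot> ar H (ar H f) = ar H f \<cdot> m (Dom A f)"
  and nat_e: "f \<in> Arr A \<Longrightarrow> Cod A f = b \<Longrightarrow> e b \<cdot> f = ar H f \<cdot> e (Dom A f)"
  and nat_\<delta>: "f \<in> Arr A \<Longrightarrow> Cod A f = b \<Longrightarrow> \<delta> b \<cdot> ar H f = ar H (ar H f) \<cdot> \<delta> (Dom A f)"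
  and nat_\<epsilon>: "f \<in> Arr A \<Longrightarrow> Cod A f = b \<Longrightarrow> \<epsilon> b \<cdot> ar H f = f \<cdot> \<epsilon> (Dom A f)"
  and nat_l: "f \<in> Arr A \<Longrightarrow> Cod A f = b \<Longrightarrow>
    l b \<cdot> ar H (ar H f) = ar H (ar H f) \<cdot> l (Dom A f)"
  using m.naturality[of f] e.naturality[of f] \<delta>.naturality[of f] \<epsilon>.naturality[of f]
    l.naturality[of f] by auto

lemmas nats = nat_m nat_e nat_\<delta> nat_\<epsilon> nat_l
  nat_m[THEN H.A.whisker] nat_e[THEN H.A.whisker] nat_\<delta>[THEN H.A.whisker]
  nat_\<epsilon>[THEN H.A.whisker] nat_l[THEN H.A.whisker]

lemma ar_unit:
  assumes "a \<in> Obj A"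
  shows "ar H (m a) \<cdot> ar H (e (ob H a)) = Id A (ob H (ob H a))"
    and "ar H (m a) \<cdot> ar H (ar H (e a)) = Id A (ob H (ob H a))"
  using assms H.ar_Comp[of "e (ob H a)" "m a"] H.ar_Comp[of "ar H (e a)" "m a"]
  by (simp_all add: m_unit_left m_unit_right)

lemmas unit_laws = m_unit_left m_unit_right \<delta>_counit_left \<delta>_counit_right ar_unit
lemmas units = unit_laws unit_laws[THEN H.A.whisker_Id]

text \<open>Naturality of \<open>e\<close> turns \<open>He \<cdot> e\<close> into
  \<open>eH \<cdot> e\<close>, and on \<open>eH\<close> the entwining is known by its unit
  law.\<close>

lemma \<delta>_e:
  assumes [simp]: "a \<in> Obj A"
  shows "\<delta> a \<cdot> e a = ar H (e a) \<cdot> e a"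
proof -
  have "\<delta> a \<cdot> e a = l a \<cdot> (ar H (e a) \<cdot> e a)"
    by (simp add: \<delta>_eq)
  also have "ar H (e a) \<cdot> e a = e (ob H a) \<cdot> e a"
    by (simp add: nat_e)
  also have "l a \<cdot> (e (ob H a) \<cdot> e a) = ar H (e a) \<cdot> e a"
    by (rule H.A.whisker_single[OF entwine_e]) simp_all
  finally show ?thesis .
qed

text \<open>Applying the counit to the previous equation yields \<open>e \<cdot> \<epsilon> \<cdot> e = e\<close>, and \<open>e\<close> can be cancelled.\<close>

lemma \<epsilon>_e:
  assumes [simp]: "a \<in> Obj A"
  shows "\<epsilon> a \<cdot> e a = Id A a"
proof -
  have "e a \<cdot> (\<epsilon> a \<cdot> e a) = \<epsilon> (ob H a) \<cdot> (\<delta> a \<cdot> e a)"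
    by (simp add: \<delta>_e nats)
  also have "\<dots> = e a \<cdot> Id A a"
    by (simp add: units)
  finally have "e a \<cdot> (\<epsilon> a \<cdot> e a) = e a \<cdot> Id A a" .
  moreover have "\<epsilon> a \<cdot> e a \<in> hom A a a" "Id A a \<in> hom A a a"
    by (simp_all add: H.A.hom_iff)
  ultimately show ?thesis
    using mono_e[OF assms] assms unfolding is_mono_def by (metis arr_e(2))
qed

lemmas \<epsilon>_e_whisker = \<epsilon>_e[THEN H.A.whisker_Id]

text \<open>With \<delta> expanded, naturality of \<open>m\<close> brings \<open>l\<close> next to
  \<open>m\<close>, where the entwining law for \<open>m\<close> applies; the remaining
  \<open>l\<close> and unit recombine to \<delta>.\<close>

lemma compat:
  assumes [simp]: "a \<in> Obj A"
  shows "\<delta> a \<cdot> m a = ar H (m a) \<cdot> (l (ob H a) \<cdot> ar H (\<delta> a))"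
proof -
  have "\<delta> a \<cdot> m a = l a \<cdot> (m (ob H a) \<cdot> ar H (ar H (e a)))"
    by (simp add: \<delta>_eq nats)
  also have "\<dots> = l a \<cdot> m (ob H a) \<cdot> ar H (ar H (e a))"
    by simp
  also have "\<dots> = ar H (m a) \<cdot> (l (ob H a) \<cdot> (ar H (l a) \<cdot> ar H (ar H (e a))))"
    unfolding entwine_m[OF assms] by simp
  finally show ?thesis
    by (simp add: \<delta>_eq)
qed

text \<open>Since \<open>\<epsilon> \<cdot> e\<close> is the identity, \<open>f\<close> is recovered
  from \<open>ar H f\<close> by composing with \<epsilon> and \<open>e\<close>.\<close>

lemma faithful_H:
  assumes "f \<in> Arr A" "g \<in> Arr A" "Dom A f = Dom A g" "Cod A f = Cod A g" "ar H f = ar H g"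
  shows "f = g"
proof -
  have "\<epsilon> (Cod A k) \<cdot> (ar H k \<cdot> e (Dom A k)) = k" if "k \<in> Arr A" for k
    using that by (simp add: nats \<epsilon>_e)
  from this[OF assms(1)] this[OF assms(2)] show ?thesis by (metis assms(3-5))
qed

section \<open>Modules, comodules and the canonical map\<close>

lemma modulesD:
  assumes "(a, h) \<in> modules A H m e"
  shows "a \<in> Obj A" "h \<in> Arr A" "Dom A h = ob H a" "Cod A h = a"
    "h \<cdot> ar H h = h \<cdot> m a" "h \<cdot> e a = Id A a"
  using assms by (auto simp: modules_def H.A.hom_iff)

lemma modulesI:
  assumes "a \<in> Obj A" "h \<in> Arr A" "Dom A h = ob H a" "Cod A h = a"
    "h \<cdot> ar H h = h \<cdot> m a" "h \<cdot> e a = Id A a"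
  shows "(a, h) \<in> modules A H m e"
  using assms by (auto simp: modules_def H.A.hom_iff)

lemma comodulesD:
  assumes "(a, \<theta>) \<in> comodules A H \<delta> \<epsilon>"
  shows "\<theta> \<in> Arr A" "Dom A \<theta> = a" "Cod A \<theta> = ob H a"
    "ar H \<theta> \<cdot> \<theta> = \<delta> a \<cdot> \<theta>" "\<epsilon> a \<cdot> \<theta> = Id A a"
  using assms by (auto simp: comodules_def H.A.hom_iff)

lemma comodulesI:
  assumes "a \<in> Obj A" "\<theta> \<in> Arr A" "Dom A \<theta> = a" "Cod A \<theta> = ob H a"
    "ar H \<theta> \<cdot> \<theta> = \<delta> a \<cdot> \<theta>" "\<epsilon> a \<cdot> \<theta> = Id A a"
  shows "(a, \<theta>) \<in> comodules A H \<delta> \<epsilon>"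
  using assms by (auto simp: comodules_def H.A.hom_iff)

lemma free_module: "a \<in> Obj A \<Longrightarrow> (ob H a, m a) \<in> modules A H m e"
  by (rule modulesI) (simp_all add: m_assoc units)

text \<open>This is the composite in \<open>cond_b\<close>; at the free module over \<open>a\<close>
  it is the component at \<open>a\<close> of the composite in \<open>cond_c\<close>.\<close>

definition canon where "canon a h = ar H h \<cdot> \<delta> a"

lemma canon_arr [simp]:
  assumes "a \<in> Obj A" "h \<in> Arr A" "Dom A h = ob H a" "Cod A h = a"
  shows "canon a h \<in> Arr A" "Dom A (canon a h) = ob H a" "Cod A (canon a h) = ob H a"
  using assms by (simp_all add: canon_def)

lemma canon_natural:
  assumes "(a, h) \<in> modules A H m e" "(b, k) \<in> modules A H m e"
    and "f \<in> Arr A" "Dom A f = a" "Cod A f = b" "f \<cdot> h = k \<cdot> ar H f"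
  shows "ar H f \<cdot> canon a h = canon b k \<cdot> ar H f"
proof -
  note [simp] = modulesD[OF assms(1)] modulesD[OF assms(2)] assms(3-5)
  have "canon b k \<cdot> ar H f = ar H (k \<cdot> ar H f) \<cdot> \<delta> a"
    by (simp add: canon_def nats)
  also have "\<dots> = ar H f \<cdot> canon a h"
    unfolding assms(6)[symmetric] by (simp add: canon_def)
  finally show ?thesis by simp
qed

text \<open>The action \<open>h\<close> is the counit at \<open>(a, h)\<close> of the comonad
  induced by the free-forgetful adjunction, so this is the counit law of the comonad morphism. It
  lets the action be read off from the canonical map.\<close>

lemma \<epsilon>_canon:
  assumes "(a, h) \<in> modules A H m e"
  shows "\<epsilon> a \<cdot> canon a h = h"
proof -
  note [simp] = modulesD(1-4)[OF assms]
  show ?thesis by (simp add: canon_def nats units)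
qed

lemma \<delta>_canon:
  assumes "(a, h) \<in> modules A H m e"
  shows "\<delta> a \<cdot> canon a h = ar H (canon a h) \<cdot> \<delta> a"
proof -
  note [simp] = modulesD(1-4)[OF assms]
  show ?thesis by (simp add: canon_def nats \<delta>_coassoc)
qed

text \<open>The composite \<open>ar H h \<cdot> l a\<close> is the lifted action on
  \<open>ob H a\<close>, so this is linearity from the free to the lifted module. It follows from
  \<open>compat\<close>, associativity of \<open>h\<close> and naturality of
  \<open>l\<close>.\<close>

lemma canon_module_hom:
  assumes "(a, h) \<in> modules A H m e"
  shows "canon a h \<cdot> m a = ar H h \<cdot> (l a \<cdot> ar H (canon a h))"
proof -
  note [simp] = modulesD(1-4)[OF assms]
  have "canon a h \<cdot> m a = ar H h \<cdot> (ar H (m a) \<cdot> (l (ob H a) \<cdot> ar H (\<delta> a)))"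
    by (simp add: canon_def compat)
  also have "\<dots> = ar H (h \<cdot> m a) \<cdot> (l (ob H a) \<cdot> ar H (\<delta> a))"
    by simp
  also have "\<dots> = ar H h \<cdot> (l a \<cdot> ar H (canon a h))"
    unfolding modulesD(5)[OF assms, symmetric] by (simp add: canon_def nats)
  finally show ?thesis .
qed

text \<open>For a Hopf algebra, where the canonical map sends \<open>x \<otimes> y\<close> to
  \<open>x\<^sub>1 \<otimes> x\<^sub>2y\<close>, these are its values at
  \<open>x \<otimes> 1\<close> and \<open>1 \<otimes> y\<close>.\<close>

lemma canon_free_e:
  assumes [simp]: "a \<in> Obj A"
  shows "canon (ob H a) (m a) \<cdot> ar H (e a) = \<delta> a"
    and "canon (ob H a) (m a) \<cdot> e (ob H a) = e (ob H a)"
proof -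
  show "canon (ob H a) (m a) \<cdot> ar H (e a) = \<delta> a"
    by (simp add: canon_def nats units)
  show "canon (ob H a) (m a) \<cdot> e (ob H a) = e (ob H a)"
    by (simp add: canon_def \<delta>_e units)
qed

text \<open>Uniqueness in the universal property of the free module: a module map out of it is
  determined by its restriction along the unit.\<close>

lemma module_hom_free:
  assumes "x \<in> Obj A" "(a, h) \<in> modules A H m e"
    and "f \<in> Arr A" "Dom A f = ob H x" "Cod A f = a" "f \<cdot> m x = h \<cdot> ar H f"
  shows "f = h \<cdot> ar H (f \<cdot> e x)"
proof -
  note [simp] = modulesD(1-4)[OF assms(2)] assms(1,3-5)
  have "h \<cdot> ar H (f \<cdot> e x) = h \<cdot> ar H f \<cdot> ar H (e x)" by simp
  also have "\<dots> = f" unfolding assms(6)[symmetric] by (simp add: units)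
  finally show ?thesis by simp
qed

end

section \<open>The canonical map on free modules and the antipode\<close>

context unital_entwining
begin

lemma canon_free_arr [simp]:
  assumes "a \<in> Obj A"
  shows "canon (ob H a) (m a) \<in> Arr A" "Dom A (canon (ob H a) (m a)) = ob H (ob H a)"
    "Cod A (canon (ob H a) (m a)) = ob H (ob H a)"
  using assms by (simp_all add: canon_arr)

lemma canon_free_natural:
  assumes "f \<in> Arr A" "Dom A f = a" "Cod A f = b"
  shows "ar H (ar H f) \<cdot> canon (ob H a) (m a) = canon (ob H b) (m b) \<cdot> ar H (ar H f)"
proof -
  have "a \<in> Obj A" "b \<in> Obj A" using assms by auto
  then show ?thesis
    by (intro canon_natural free_module) (use assms in \<open>simp_all add: nats\<close>)
qed

text \<open>The family is natural because each \<open>ar H f\<close> is a map of free modules, so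
  only invertibility of the components is left.\<close>

lemma canon_free_iso_iff:
  "nat_iso A A (H \<cdot>\<cdot> H) (H \<cdot>\<cdot> H) (\<lambda>a. ar H (m a) \<cdot> \<delta> (ob H a)) \<longleftrightarrow>
   (\<forall>a \<in> Obj A. is_iso A (canon (ob H a) (m a)))"
proof -
  have "nat_trans A A (H \<cdot>\<cdot> H) (H \<cdot>\<cdot> H) (\<lambda>a. canon (ob H a) (m a))"
    by (rule nat_transI) (simp_all add: functor_comp[OF H.cat_functor_axioms H.cat_functor_axioms]
      canon_free_natural)
  then show ?thesis
    unfolding nat_iso_iff by (simp add: canon_def)
qed

text \<open>
  Every module is a split coequalizer of free ones in the base category, so that the inverse on
  a free module descends along its action.
\<close>

lemma canon_iso_of_free:
  assumes iso: "\<And>a. a \<in> Obj A \<Longrightarrow> is_iso A (canon (ob H a) (m a))"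
    and mod: "(a, h) \<in> modules A H m e"
  shows "is_iso A (canon a h)"
proof -
  note M = modulesD[OF mod]
  note [simp] = M(1-4)
  obtain \<sigma> where \<sigma>: "\<sigma> \<in> Arr A" "Dom A \<sigma> = ob H (ob H a)" "Cod A \<sigma> = ob H (ob H a)"
    "\<sigma> \<cdot> canon (ob H a) (m a) = Id A (ob H (ob H a))"
    "canon (ob H a) (m a) \<cdot> \<sigma> = Id A (ob H (ob H a))"
    using iso[OF M(1)] by (rule H.A.is_isoE) (use M(1) in simp)
  obtain \<tau> where \<tau>: "\<tau> \<in> Arr A" "Dom A \<tau> = ob H (ob H (ob H a))"
    "Cod A \<tau> = ob H (ob H (ob H a))"
    "canon (ob H (ob H a)) (m (ob H a)) \<cdot> \<tau> = Id A (ob H (ob H (ob H a)))"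
    using iso[OF H.ob_Obj[OF M(1)]] by (rule H.A.is_isoE) (use M(1) in simp)
  note [simp] = \<sigma>(1-3) \<tau>(1-3)
  \<comment> \<open>By associativity \<open>h\<close> is itself a module map from the free module on
    \<open>a\<close> to \<open>(a, h)\<close>.\<close>
  have free: "canon a h \<cdot> ar H h = ar H h \<cdot> canon (ob H a) (m a)"
    by (rule canon_natural[symmetric]) (use mod in \<open>simp_all add: free_module M(5)\<close>)
  \<comment> \<open>The inverses commute with both arrows of the parallel pair
    \<open>ar H (ar H h)\<close>, \<open>ar H (m a)\<close>; hence \<open>Y\<close> below
    coequalizes this pair.\<close>
  have \<sigma>h: "\<sigma> \<cdot> ar H (ar H h) = ar H (ar H h) \<cdot> \<tau>"
    by (rule H.A.inverse_square[OF canon_free_natural[OF M(2-4)]])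
      (use \<sigma>(4) \<tau>(4) in simp_all)
  have \<sigma>m: "\<sigma> \<cdot> ar H (m a) = ar H (m a) \<cdot> \<tau>"
  proof (rule H.A.inverse_square)
    show "ar H (m a) \<cdot> canon (ob H (ob H a)) (m (ob H a)) = canon (ob H a) (m a) \<cdot> ar H (m a)"
      by (rule canon_natural) (use M(1) in \<open>simp_all add: free_module m_assoc\<close>)
  qed (use \<sigma>(4) \<tau>(4) M(1) in simp_all)
  have hm: "ar H h \<cdot> ar H (ar H h) = ar H h \<cdot> ar H (m a)"
    using arg_cong[OF M(5), of "ar H"] M(1-4) by simp
  define Y where "Y = ar H h \<cdot> \<sigma>"
  have Y [simp]: "Y \<in> Arr A" "Dom A Y = ob H (ob H a)" "Cod A Y = ob H a"
    by (simp_all add: Y_def)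
  have "Y \<cdot> ar H (ar H h) = Y \<cdot> ar H (m a)"
    by (simp add: Y_def \<sigma>h \<sigma>m H.A.whisker[OF hm])
  \<comment> \<open>Precomposing with the splitting \<open>ar H (e (ob H a))\<close> makes
    \<open>Y\<close> factor through \<open>ar H h\<close>; the factor
    \<open>Y \<cdot> ar H (e a)\<close> is the desired inverse.\<close>
  then have "Y \<cdot> (ar H (ar H h) \<cdot> ar H (e (ob H a))) = Y \<cdot> (ar H (m a) \<cdot> ar H (e (ob H a)))"
    by (rule H.A.whisker) simp_all
  moreover have "ar H (ar H h) \<cdot> ar H (e (ob H a)) = ar H (e a) \<cdot> ar H h"
    using arg_cong[OF nat_e[of h a], of "ar H"] M(1-4) by simp
  ultimately have YX: "(Y \<cdot> ar H (e a)) \<cdot> ar H h = Y"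
    by (simp add: units)
  have he: "ar H h \<cdot> ar H (e a) = Id A (ob H a)"
    using arg_cong[OF M(6), of "ar H"] M(1-4) by simp
  show ?thesis
  proof (rule H.A.is_isoI[where g = "Y \<cdot> ar H (e a)"])
    have "canon a h \<cdot> (Y \<cdot> ar H (e a)) = canon a h \<cdot> ar H h \<cdot> (\<sigma> \<cdot> ar H (e a))"
      by (simp add: Y_def)
    also have "\<dots> = ar H h \<cdot> (canon (ob H a) (m a) \<cdot> (\<sigma> \<cdot> ar H (e a)))"
      unfolding free by simp
    also have "canon (ob H a) (m a) \<cdot> (\<sigma> \<cdot> ar H (e a)) = ar H (e a)"
      by (rule H.A.whisker_Id[OF \<sigma>(5)]) simp_all
    finally show "canon a h \<cdot> (Y \<cdot> ar H (e a)) = Id A (Cod A (canon a h))"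
      by (simp add: he)
    \<comment> \<open>The left inverse law is checked after \<open>ar H h\<close>, which is then
      cancelled by its section \<open>ar H (e a)\<close>.\<close>
    have "(Y \<cdot> ar H (e a)) \<cdot> canon a h \<cdot> ar H h
        = (Y \<cdot> ar H (e a)) \<cdot> (ar H h \<cdot> canon (ob H a) (m a))"
      unfolding free[symmetric] by simp
    also have "\<dots> = (Y \<cdot> ar H (e a)) \<cdot> ar H h \<cdot> canon (ob H a) (m a)"
      by simp
    also have "\<dots> = ar H h"
      unfolding YX by (simp add: Y_def \<sigma>(4))
    finally have "(Y \<cdot> ar H (e a)) \<cdot> canon a h \<cdot> ar H h \<cdot> ar H (e a) = ar H h \<cdot> ar H (e a)"
      by simp
    then show "(Y \<cdot> ar H (e a)) \<cdot> canon a h = Id A (Dom A (canon a h))"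
      by (simp add: he)
  qed simp_all
qed

text \<open>
  The antipode is the composite \<open>\<epsilon>H \<cdot> \<gamma>\<^sup>-\<^sup>1 \<cdot> He\<close>, where \<open>\<gamma> = Hm \<cdot> \<delta>H\<close>. For a Hopf algebra,
  \<open>\<gamma>\<^sup>-\<^sup>1\<close> sends \<open>x \<otimes> y\<close> to \<open>x\<^sub>1 \<otimes> S(x\<^sub>2)y\<close>.
\<close>

lemma antipode_exists:
  assumes "nat_iso A A (H \<cdot>\<cdot> H) (H \<cdot>\<cdot> H) (\<lambda>a. ar H (m a) \<cdot> \<delta> (ob H a))"
  shows "\<exists>S. is_antipode A H m e \<delta> \<epsilon> S"
proof -
  define \<gamma> where "\<gamma> a = canon (ob H a) (m a)" for a
  have \<gamma> [simp]: "\<gamma> a \<in> Arr A" "Dom A (\<gamma> a) = ob H (ob H a)" "Cod A (\<gamma> a) = ob H (ob H a)"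
    if "a \<in> Obj A" for a
    unfolding \<gamma>_def using that by simp_all
  obtain \<sigma> where nat_trans: "nat_trans A A (H \<cdot>\<cdot> H) (H \<cdot>\<cdot> H) \<sigma>"
    and \<sigma>\<gamma>: "\<And>a. a \<in> Obj A \<Longrightarrow> \<sigma> a \<cdot> \<gamma> a = Id A (ob H (ob H a))"
    and \<gamma>\<sigma>: "\<And>a. a \<in> Obj A \<Longrightarrow> \<gamma> a \<cdot> \<sigma> a = Id A (ob H (ob H a))"
    using assms unfolding nat_iso_def \<gamma>_def canon_def comp_ftr_simps by blast
  interpret \<sigma>: nat_trans A A "H \<cdot>\<cdot> H" "H \<cdot>\<cdot> H" \<sigma> by fact
  have \<sigma> [simp]: "\<sigma> a \<in> Arr A" "Dom A (\<sigma> a) = ob H (ob H a)" "Cod A (\<sigma> a) = ob H (ob H a)"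
    if "a \<in> Obj A" for a
    using \<sigma>.component_arr[OF that] by simp_all
  have nat_\<sigma>: "\<sigma> b \<cdot> ar H (ar H f) = ar H (ar H f) \<cdot> \<sigma> (Dom A f)"
    if "f \<in> Arr A" "Cod A f = b" for f b
    using \<sigma>.naturality[OF that(1)] that by simp
  have m\<sigma>: "m a \<cdot> \<sigma> a = \<epsilon> (ob H a)" if [simp]: "a \<in> Obj A" for a
  proof -
    have "\<epsilon> (ob H a) \<cdot> \<gamma> a = m a"
      unfolding \<gamma>_def by (rule \<epsilon>_canon) (simp add: free_module)
    then have "m a \<cdot> \<sigma> a = \<epsilon> (ob H a) \<cdot> \<gamma> a \<cdot> \<sigma> a" by simp
    then show ?thesis by (simp add: \<gamma>\<sigma>)
  qed
  have \<sigma>_linear: "\<sigma> a \<cdot> ar H (m a) = ar H (m a) \<cdot> \<sigma> (ob H a)" if "a \<in> Obj A" for a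
  proof (rule H.A.inverse_square)
    show "ar H (m a) \<cdot> \<gamma> (ob H a) = \<gamma> a \<cdot> ar H (m a)"
      unfolding \<gamma>_def by (rule canon_natural) (use that in \<open>simp_all add: free_module m_assoc\<close>)
  qed (use that in \<open>simp_all add: \<sigma>\<gamma> \<gamma>\<sigma>\<close>)
  \<comment> \<open>The canonical map commutes with right multiplication and with \<delta>, hence so
    does its inverse.\<close>
  have \<sigma>_colinear: "ar H (\<sigma> a) \<cdot> \<delta> (ob H a) = \<delta> (ob H a) \<cdot> \<sigma> a" if "a \<in> Obj A" for a
  proof (rule H.A.inverse_square)
    show "\<delta> (ob H a) \<cdot> \<gamma> a = ar H (\<gamma> a) \<cdot> \<delta> (ob H a)"
      unfolding \<gamma>_def by (rule \<delta>_canon) (use that in \<open>simp add: free_module\<close>)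
    show "ar H (\<sigma> a) \<cdot> ar H (\<gamma> a) = Id A (Cod A (\<delta> (ob H a)))"
      using arg_cong[OF \<sigma>\<gamma>[OF that], of "ar H"] that by simp
  qed (use that in \<open>simp_all add: \<gamma>\<sigma>\<close>)
  define S where "S a = \<epsilon> (ob H a) \<cdot> (\<sigma> a \<cdot> ar H (e a))" for a
  have S [simp]: "S a \<in> Arr A" "Dom A (S a) = ob H a" "Cod A (S a) = ob H a"
    if "a \<in> Obj A" for a
    using that by (simp_all add: S_def)
  have "nat_trans A A H H S"
  proof (rule nat_transI[OF H.cat_functor_axioms H.cat_functor_axioms])
    fix f assume f: "f \<in> Arr A"
    have he: "ar H (e (Cod A f)) \<cdot> ar H f = ar H (ar H f) \<cdot> ar H (e (Dom A f))"
      using arg_cong[OF nat_e[OF f refl], of "ar H"] f by simp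
    show "ar H f \<cdot> S (Dom A f) = S (Cod A f) \<cdot> ar H f"
      using f by (simp add: S_def he H.A.whisker[OF nat_\<sigma>] nats)
  qed simp
  moreover have "m a \<cdot> ar H (S a) \<cdot> \<delta> a = e a \<cdot> \<epsilon> a" if [simp]: "a \<in> Obj A" for a
  proof -
    \<comment> \<open>Colinearity moves \<delta> to the left of \<sigma>, where the counit cancels
      it: \<open>HS \<cdot> \<delta>\<close> is \<open>\<sigma> \<cdot> He\<close>.\<close>
    have "ar H (S a) \<cdot> \<delta> a = ar H (\<epsilon> (ob H a)) \<cdot> (ar H (\<sigma> a) \<cdot> (\<delta> (ob H a) \<cdot> ar H (e a)))"
      by (simp add: S_def nats)
    also have "\<dots> = ar H (\<epsilon> (ob H a)) \<cdot> (\<delta> (ob H a) \<cdot> (\<sigma> a \<cdot> ar H (e a)))"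
      by (simp only: H.A.whisker[OF \<sigma>_colinear] that \<sigma> H.ar_arr arr_e arr_\<delta> H.ob_Obj)
    also have "\<dots> = \<sigma> a \<cdot> ar H (e a)"
      by (simp add: units)
    finally have "m a \<cdot> (ar H (S a) \<cdot> \<delta> a) = m a \<cdot> (\<sigma> a \<cdot> ar H (e a))" by simp
    also have "\<dots> = e a \<cdot> \<epsilon> a"
      by (simp add: H.A.whisker_single[OF m\<sigma>] nats)
    finally show ?thesis by simp
  qed
  moreover have "m a \<cdot> S (ob H a) \<cdot> \<delta> a = e a \<cdot> \<epsilon> a" if [simp]: "a \<in> Obj A" for a
  proof -
    \<comment> \<open>Linearity moves \<open>m\<close> past \<sigma>, where the unit cancels it,
      giving \<open>\<epsilon>H \<cdot> \<sigma>\<close>. Then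
      \<open>\<delta> = \<gamma> \<cdot> He\<close> lets \<sigma> cancel \<gamma>.\<close>
    have "m a \<cdot> S (ob H a) = \<epsilon> (ob H a) \<cdot> (ar H (m a) \<cdot> (\<sigma> (ob H a) \<cdot> ar H (e (ob H a))))"
      by (simp add: S_def nats)
    also have "\<dots> = \<epsilon> (ob H a) \<cdot> (\<sigma> a \<cdot> (ar H (m a) \<cdot> ar H (e (ob H a))))"
      by (simp add: H.A.whisker[OF \<sigma>_linear])
    also have "\<dots> = \<epsilon> (ob H a) \<cdot> \<sigma> a"
      by (simp add: units)
    finally have "m a \<cdot> S (ob H a) \<cdot> \<delta> a = \<epsilon> (ob H a) \<cdot> (\<sigma> a \<cdot> (\<gamma> a \<cdot> ar H (e a)))"
      by (simp add: \<gamma>_def canon_free_e)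
    also have "\<sigma> a \<cdot> (\<gamma> a \<cdot> ar H (e a)) = ar H (e a)"
      by (rule H.A.whisker_Id[OF \<sigma>\<gamma>]) simp_all
    finally show ?thesis by (simp add: nats)
  qed
  ultimately show ?thesis
    unfolding is_antipode_def by blast
qed

text \<open>The two comultiplication laws of a bimonad come from \<open>compat\<close> and
  \<open>\<delta>_e\<close>, the counit laws from the augmentation.\<close>

lemma hopf_monad_of_augmentation:
  assumes "nat_iso A A (H \<cdot>\<cdot> H) (H \<cdot>\<cdot> H) (\<lambda>a. ar H (m a) \<cdot> \<delta> (ob H a))"
    and "is_augmentation A H m e \<epsilon>"
  shows "hopf_monad A H m e \<delta> \<epsilon> l"
proof unfold_locales
  show "\<exists>S. is_antipode A H m e \<delta> \<epsilon> S"
    using assms(1) by (rule antipode_exists)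
  show "\<delta> a \<cdot> m a = ar H (m a) \<cdot> l (ob H a) \<cdot> ar H (\<delta> a)" if "a \<in> Obj A" for a
    using compat[OF that] that by simp
qed (use assms(2) \<delta>_e in \<open>auto simp: is_augmentation_def\<close>)

end

section \<open>The category of bimodules\<close>

context unital_entwining
begin

abbreviation B where "B \<equiv> bimod_cat A H m e \<delta> \<epsilon> l"

abbreviation Bimod where "Bimod \<equiv> bimodules A H m e \<delta> \<epsilon> l"

lemma bimodulesD:
  assumes "(a, h, \<theta>) \<in> Bimod"
  shows "(a, h) \<in> modules A H m e" "(a, \<theta>) \<in> comodules A H \<delta> \<epsilon>"
    "\<theta> \<cdot> h = ar H h \<cdot> (l a \<cdot> ar H \<theta>)"
proof -
  show *: "(a, h) \<in> modules A H m e" "(a, \<theta>) \<in> comodules A H \<delta> \<epsilon>"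
    using assms by (auto simp: bimodules_def)
  show "\<theta> \<cdot> h = ar H h \<cdot> (l a \<cdot> ar H \<theta>)"
    using assms modulesD(1-4)[OF *(1)] comodulesD(1-3)[OF *(2)] by (simp add: bimodules_def)
qed

lemma bimodulesI:
  assumes "(a, h) \<in> modules A H m e" "(a, \<theta>) \<in> comodules A H \<delta> \<epsilon>"
    "\<theta> \<cdot> h = ar H h \<cdot> (l a \<cdot> ar H \<theta>)"
  shows "(a, h, \<theta>) \<in> Bimod"
  using assms modulesD(1-4)[OF assms(1)] comodulesD(1-3)[OF assms(2)] by (simp add: bimodules_def)

lemma bimod_arr_iff:
  "((a, h, \<theta>), (b, k, \<zeta>), f) \<in> Arr B \<longleftrightarrow>
     (a, h, \<theta>) \<in> Bimod \<and> (b, k, \<zeta>) \<in> Bimod \<and> f \<in> Arr A \<and> Dom A f = a \<and> Cod A f = b \<and>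
     f \<cdot> h = k \<cdot> ar H f \<and> \<zeta> \<cdot> f = ar H f \<cdot> \<theta>"
  by (auto simp: bimod_cat_def module_hom_def comodule_hom_def H.A.hom_iff)

lemma bimod_hom_iff:
  "\<psi> \<in> hom B x y \<longleftrightarrow> (\<exists>f. \<psi> = (x, y, f) \<and> (x, y, f) \<in> Arr B)"
  by (auto simp: hom_def bimod_cat_def)

lemma bimod_Obj [simp]: "Obj B = Bimod"
  by (simp add: bimod_cat_def)

lemma bimod_Dom_Cod [simp]: "Dom B (x, y, f) = x" "Cod B (x, y, f) = y"
  by (simp_all add: bimod_cat_def)

lemma bimod_Id [simp]: "Id B (a, h, \<theta>) = ((a, h, \<theta>), (a, h, \<theta>), Id A a)"
  by (simp add: bimod_cat_def)

lemma bimod_Comp [simp]: "Comp B (y', z, g) (x, y, f) = (x, z, g \<cdot> f)"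
  by (simp add: bimod_cat_def)

lemma bimod_comp_arr:
  assumes "((a, h, \<theta>), (b, k, \<zeta>), f) \<in> Arr B" "((b, k, \<zeta>), (c, n, \<xi>), g) \<in> Arr B"
  shows "((a, h, \<theta>), (c, n, \<xi>), g \<cdot> f) \<in> Arr B"
proof -
  note F = assms(1)[unfolded bimod_arr_iff] and G = assms(2)[unfolded bimod_arr_iff]
  have bm: "(a, h, \<theta>) \<in> Bimod" "(b, k, \<zeta>) \<in> Bimod" "(c, n, \<xi>) \<in> Bimod"
    using F G by auto
  note [simp] = modulesD(1-4)[OF bimodulesD(1)[OF bm(1)]] comodulesD(1-3)[OF bimodulesD(2)[OF bm(1)]]
    modulesD(1-4)[OF bimodulesD(1)[OF bm(2)]] comodulesD(1-3)[OF bimodulesD(2)[OF bm(2)]]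
    modulesD(1-4)[OF bimodulesD(1)[OF bm(3)]] comodulesD(1-3)[OF bimodulesD(2)[OF bm(3)]]
  have f [simp]: "f \<in> Arr A" "Dom A f = a" "Cod A f = b"
    and g [simp]: "g \<in> Arr A" "Dom A g = b" "Cod A g = c"
    and fh: "f \<cdot> h = k \<cdot> ar H f" "\<zeta> \<cdot> f = ar H f \<cdot> \<theta>"
    and gk: "g \<cdot> k = n \<cdot> ar H g" "\<xi> \<cdot> g = ar H g \<cdot> \<zeta>"
    using F G by auto
  have "g \<cdot> f \<cdot> h = n \<cdot> ar H (g \<cdot> f)"
    by (simp add: fh H.A.whisker[OF gk(1)])
  moreover have "\<xi> \<cdot> (g \<cdot> f) = ar H (g \<cdot> f) \<cdot> \<theta>"
    by (simp add: fh H.A.whisker[OF gk(2)])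
  ultimately show ?thesis
    unfolding bimod_arr_iff using bm by simp
qed

lemma bimod_category: "category B"
proof
  show "Id B x \<in> hom B x x" if x: "x \<in> Obj B" for x
  proof -
    obtain a h \<theta> where [simp]: "x = (a, h, \<theta>)" by (cases x)
    note [simp] = modulesD(1-4)[OF bimodulesD(1)] comodulesD(1-3)[OF bimodulesD(2)]
    show ?thesis using x by (simp add: bimod_hom_iff bimod_arr_iff)
  qed
  show "Comp B g f \<in> hom B x z" if fg: "f \<in> hom B x y" "g \<in> hom B y z" for f g x y z
  proof -
    obtain f' g' where "f = (x, y, f')" "(x, y, f') \<in> Arr B" "g = (y, z, g')" "(y, z, g') \<in> Arr B"
      using fg unfolding bimod_hom_iff by blast
    then show ?thesis
      by (cases x; cases y; cases z) (auto simp: bimod_hom_iff intro: bimod_comp_arr)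
  qed
qed (auto simp: bimod_hom_iff bimod_arr_iff)

section \<open>Free and cofree bimodules and the maps between them\<close>

lemma free_bimodule:
  assumes "a \<in> Obj A"
  shows "(ob H a, m a, \<delta> a) \<in> Bimod"
  by (intro bimodulesI free_module comodulesI) (use assms in \<open>simp_all add: \<delta>_coassoc units compat\<close>)

text \<open>The entwining lifts the comonad to modules: its laws for \<open>e\<close> and
  \<open>m\<close> make \<open>ar H h \<cdot> l a\<close> an action, and its law for \<delta> is
  what the bimodule condition requires.\<close>

lemma cofree_bimodule:
  assumes mod: "(a, h) \<in> modules A H m e"
  shows "(ob H a, ar H h \<cdot> l a, \<delta> a) \<in> Bimod"
proof (intro bimodulesI modulesI comodulesI)
  note [simp] = modulesD(1-4)[OF mod]
  have e_l: "l a \<cdot> (e (ob H a) \<cdot> x) = ar H (e a) \<cdot> x"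
    if "x \<in> Arr A" "Cod A x = ob H a" for x
    using that by (intro H.A.whisker_single[OF entwine_e]) simp_all
  show "ar H h \<cdot> l a \<cdot> e (ob H a) = Id A (ob H a)"
    using arg_cong[OF modulesD(6)[OF mod], of "ar H"] by (simp add: entwine_e)
  have "ar H h \<cdot> l a \<cdot> ar H (ar H h \<cdot> l a) = ar H (h \<cdot> ar H h) \<cdot> (l (ob H a) \<cdot> ar H (l a))"
    by (simp add: nats)
  also have "\<dots> = ar H h \<cdot> (ar H (m a) \<cdot> l (ob H a) \<cdot> ar H (l a))"
    unfolding modulesD(5)[OF mod] by simp
  also have "\<dots> = ar H h \<cdot> l a \<cdot> m (ob H a)"
    unfolding entwine_m[OF modulesD(1)[OF mod], symmetric] by simp
  finally show "ar H h \<cdot> l a \<cdot> ar H (ar H h \<cdot> l a) = ar H h \<cdot> l a \<cdot> m (ob H a)" .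
  have "\<delta> a \<cdot> (ar H h \<cdot> l a) = ar H (ar H h) \<cdot> (\<delta> (ob H a) \<cdot> l a)"
    by (simp add: nats)
  also have "\<dots> = ar H (ar H h \<cdot> l a) \<cdot> (l (ob H a) \<cdot> ar H (\<delta> a))"
    by (simp add: entwine_\<delta>)
  finally show "\<delta> a \<cdot> (ar H h \<cdot> l a) = ar H (ar H h \<cdot> l a) \<cdot> (l (ob H a) \<cdot> ar H (\<delta> a))" .
qed (use modulesD(1-4)[OF mod] in \<open>simp_all add: \<delta>_coassoc units\<close>)

text \<open>Bimodule maps from a free bimodule into a cofree one correspond to maps \<open>x \<rightarrow> a\<close>.\<close>

lemma hom_free_cofree:
  assumes "x \<in> Obj A" and mod: "(a, h) \<in> modules A H m e"
    and \<psi>: "((ob H x, m x, \<delta> x), (ob H a, ar H h \<cdot> l a, \<delta> a), \<psi>) \<in> Arr B"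
  shows "\<psi> = canon a h \<cdot> ar H (\<epsilon> a \<cdot> (\<psi> \<cdot> e x))"
proof -
  note [simp] = modulesD(1-4)[OF mod] assms(1)
  have [simp]: "\<psi> \<in> Arr A" "Dom A \<psi> = ob H x" "Cod A \<psi> = ob H a"
    and \<psi>m: "\<psi> \<cdot> m x = ar H h \<cdot> (l a \<cdot> ar H \<psi>)" and \<psi>\<delta>: "\<delta> a \<cdot> \<psi> = ar H \<psi> \<cdot> \<delta> x"
    using \<psi> by (auto simp: bimod_arr_iff)
  \<comment> \<open>The counit law of the entwining makes \<open>\<epsilon> a \<cdot> \<psi>\<close>
    a module map into \<open>(a, h)\<close>, so freeness of the source applies.\<close>
  have "\<epsilon> a \<cdot> \<psi> \<cdot> m x = h \<cdot> (\<epsilon> (ob H a) \<cdot> l a) \<cdot> ar H \<psi>"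
    by (simp add: \<psi>m nats)
  also have "\<dots> = h \<cdot> ar H (\<epsilon> a \<cdot> \<psi>)"
    by (simp add: entwine_\<epsilon>)
  finally have g: "\<epsilon> a \<cdot> \<psi> = h \<cdot> ar H (\<epsilon> a \<cdot> \<psi> \<cdot> e x)"
    by (intro module_hom_free[OF assms(1) mod]) simp_all
  \<comment> \<open>Cofreeness of the target recovers \<psi> from
    \<open>\<epsilon> a \<cdot> \<psi>\<close>.\<close>
  have "\<psi> = ar H (\<epsilon> a) \<cdot> (\<delta> a \<cdot> \<psi>)"
    by (simp add: units)
  also have "\<dots> = ar H (\<epsilon> a \<cdot> \<psi>) \<cdot> \<delta> x"
    by (simp add: \<psi>\<delta>)
  also have "\<dots> = ar H (h \<cdot> ar H (\<epsilon> a \<cdot> \<psi> \<cdot> e x)) \<cdot> \<delta> x"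
    using g by metis
  also have "\<dots> = canon a h \<cdot> ar H (\<epsilon> a \<cdot> (\<psi> \<cdot> e x))"
    by (simp add: canon_def nats)
  finally show ?thesis .
qed

lemma canon_bimod_arr:
  assumes mod: "(a, h) \<in> modules A H m e"
  shows "((ob H a, m a, \<delta> a), (ob H a, ar H h \<cdot> l a, \<delta> a), canon a h) \<in> Arr B"
  using modulesD(1-4)[OF mod] canon_module_hom[OF mod] \<delta>_canon[OF mod]
    free_bimodule[OF modulesD(1)[OF mod]] cofree_bimodule[OF mod]
  by (simp add: bimod_arr_iff)

section \<open>The functor \<open>K_e\<close>, and the canonical maps when it is an
  equivalence\<close>

interpretation B: category B
  by (rule bimod_category)

lemma K_ob [simp]: "ob (K_e A H m \<delta>) a = (ob H a, m a, \<delta> a)"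
  by (simp add: K_e_def)

lemma K_ar: "f \<in> hom A a b \<Longrightarrow>
    ar (K_e A H m \<delta>) f = ((ob H a, m a, \<delta> a), (ob H b, m b, \<delta> b), ar H f)"
  by (auto simp: K_e_def hom_def)

lemma K_functor: "cat_functor A B (K_e A H m \<delta>)"
proof unfold_locales
  show "ob (K_e A H m \<delta>) a \<in> Obj B" if "a \<in> Obj A" for a
    using that by (simp add: free_bimodule)
  show "ar (K_e A H m \<delta>) f \<in> hom B (ob (K_e A H m \<delta>) a) (ob (K_e A H m \<delta>) b)"
    if f: "f \<in> hom A a b" for f a b
  proof -
    have [simp]: "f \<in> Arr A" "Dom A f = a" "Cod A f = b" using f by (auto simp: H.A.hom_iff)
    have [simp]: "a \<in> Obj A" "b \<in> Obj A" using H.A.Dom_Obj[of f] H.A.Cod_Obj[of f] by auto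
    show ?thesis
      using f by (simp add: K_ar bimod_hom_iff bimod_arr_iff free_bimodule nats)
  qed
  show "ar (K_e A H m \<delta>) (Id A a) = Id B (ob (K_e A H m \<delta>) a)" if "a \<in> Obj A" for a
    using that K_ar[OF H.A.id_hom[OF that]] by simp
  show "ar (K_e A H m \<delta>) (g \<cdot> f) = Comp B (ar (K_e A H m \<delta>) g) (ar (K_e A H m \<delta>) f)"
    if "f \<in> hom A a b" "g \<in> hom A b c" for f g a b c
    using that H.A.comp_hom[OF that] by (simp add: K_ar H.ar_comp)
qed

text \<open>An isomorphism \<phi> from some free bimodule to the cofree one satisfies
  \<open>canon a h = \<phi> \<cdot> ar H u\<close> by fullness and
  \<open>\<phi> = canon a h \<cdot> ar H v\<close> by \<open>hom_free_cofree\<close>. It remains to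
  see that \<open>u\<close> and \<open>v\<close> become mutually inverse under
  \<open>H\<close>.\<close>

lemma canon_iso_of_equivalence:
  assumes eqv: "is_equivalence A B (K_e A H m \<delta>)" and mod: "(a, h) \<in> modules A H m e"
  shows "is_iso A (canon a h)"
proof -
  note M = modulesD[OF mod]
  note [simp] = M(1-4)
  let ?C = "(ob H a, ar H h \<cdot> l a, \<delta> a)"
  have C: "?C \<in> Obj B"
    using cofree_bimodule[OF mod] by simp
  obtain b \<psi> where b [simp]: "b \<in> Obj A" and \<psi>: "\<psi> \<in> hom B (ob (K_e A H m \<delta>) b) ?C" "is_iso B \<psi>"
    by (rule equivalence_eso[OF eqv C])
  obtain \<phi> where \<phi>: "\<psi> = ((ob H b, m b, \<delta> b), ?C, \<phi>)" "((ob H b, m b, \<delta> b), ?C, \<phi>) \<in> Arr B"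
    using \<psi>(1) unfolding bimod_hom_iff K_ob by blast
  obtain \<psi>' where \<psi>': "\<psi>' \<in> hom B ?C (ob H b, m b, \<delta> b)"
      "Comp B \<psi>' \<psi> = Id B (ob H b, m b, \<delta> b)" "Comp B \<psi> \<psi>' = Id B ?C"
    using \<psi>(2) unfolding is_iso_def \<phi>(1) bimod_Dom_Cod by blast
  then obtain \<phi>' where \<phi>': "\<psi>' = (?C, (ob H b, m b, \<delta> b), \<phi>')" "(?C, (ob H b, m b, \<delta> b), \<phi>') \<in> Arr B"
    unfolding bimod_hom_iff by blast
  have [simp]: "\<phi> \<in> Arr A" "Dom A \<phi> = ob H b" "Cod A \<phi> = ob H a"
    "\<phi>' \<in> Arr A" "Dom A \<phi>' = ob H a" "Cod A \<phi>' = ob H b"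
    using \<phi>(2) \<phi>'(2) by (auto simp: bimod_arr_iff)
  have inv: "\<phi>' \<cdot> \<phi> = Id A (ob H b)" "\<phi> \<cdot> \<phi>' = Id A (ob H a)"
    using \<psi>' by (auto simp: \<phi>(1) \<phi>'(1))
  have "((ob H a, m a, \<delta> a), (ob H b, m b, \<delta> b), \<phi>' \<cdot> canon a h)
      \<in> hom B (ob (K_e A H m \<delta>) a) (ob (K_e A H m \<delta>) b)"
    unfolding bimod_hom_iff using bimod_comp_arr[OF canon_bimod_arr[OF mod] \<phi>'(2)] by simp
  then obtain u where u: "u \<in> hom A a b"
    "ar (K_e A H m \<delta>) u = ((ob H a, m a, \<delta> a), (ob H b, m b, \<delta> b), \<phi>' \<cdot> canon a h)"
    by (rule equivalence_full[OF eqv M(1) b])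
  then have Hu: "ar H u = \<phi>' \<cdot> canon a h" by (simp add: K_ar)
  have [simp]: "u \<in> Arr A" "Dom A u = a" "Cod A u = b" using u(1) by (auto simp: H.A.hom_iff)
  define v where "v = \<epsilon> a \<cdot> (\<phi> \<cdot> e b)"
  have [simp]: "v \<in> Arr A" "Dom A v = b" "Cod A v = a" by (simp_all add: v_def)
  have \<phi>v: "\<phi> = canon a h \<cdot> ar H v"
    unfolding v_def by (rule hom_free_cofree[OF b mod \<phi>(2)])
  have can: "canon a h = \<phi> \<cdot> ar H u"
    unfolding Hu by (simp add: H.A.whisker_Id[OF inv(2)])
  have Huv: "ar H u \<cdot> ar H v = Id A (ob H b)"
    unfolding Hu using inv(1) \<phi>v by simp
  have "canon a h \<cdot> ar H (v \<cdot> u) = canon a h"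
    using can \<phi>v by (metis H.A.comp_assoc H.ar_Comp H.ar_arr canon_arr M(1-4)
      \<open>u \<in> Arr A\<close> \<open>v \<in> Arr A\<close> \<open>Dom A v = b\<close> \<open>Cod A u = b\<close> \<open>Cod A v = a\<close>)
  \<comment> \<open>The counit reduces the canonical map to \<open>h\<close>, and the unit law of
    \<open>h\<close> then strips off \<open>H\<close>, leaving \<open>v \<cdot> u\<close>.\<close>
  then have "\<epsilon> a \<cdot> (canon a h \<cdot> ar H (v \<cdot> u)) = \<epsilon> a \<cdot> canon a h" by simp
  then have "h \<cdot> ar H (v \<cdot> u) = h"
    by (simp add: H.A.whisker_single[OF \<epsilon>_canon[OF mod]] \<epsilon>_canon[OF mod])
  then have "h \<cdot> ar H (v \<cdot> u) \<cdot> e a = Id A a"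
    using M(6) by simp
  moreover have "h \<cdot> ar H (v \<cdot> u) \<cdot> e a = h \<cdot> (e a \<cdot> (v \<cdot> u))"
    by (simp add: nats)
  moreover have "\<dots> = v \<cdot> u"
    by (rule H.A.whisker_Id[OF M(6)]) simp_all
  ultimately have "v \<cdot> u = Id A a"
    by simp
  then have Hvu: "ar H v \<cdot> ar H u = Id A (ob H a)"
    using H.ar_Comp[of u v] by simp
  show ?thesis
    by (rule H.A.is_isoI[where g = "ar H v \<cdot> \<phi>'"])
      (simp_all add: can H.A.whisker_Id[OF inv(1)] H.A.whisker_Id[OF Huv] inv Hvu)
qed

end

section \<open>Equivalence from invertible canonical maps\<close>

context unital_entwining
begin

text \<open>An inverse in \<open>A\<close> inherits linearity and colinearity by inverting the two
  structure squares.\<close>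

lemma bimod_isoI:
  assumes f: "((a, h, \<theta>), (b, k, \<zeta>), f) \<in> Arr B"
    and g [simp]: "g \<in> Arr A" "Dom A g = b" "Cod A g = a" and inv: "g \<cdot> f = Id A a" "f \<cdot> g = Id A b"
  shows "is_iso B ((a, h, \<theta>), (b, k, \<zeta>), f)"
proof -
  have bm: "(a, h, \<theta>) \<in> Bimod" "(b, k, \<zeta>) \<in> Bimod"
    and f' [simp]: "f \<in> Arr A" "Dom A f = a" "Cod A f = b"
    and fh: "f \<cdot> h = k \<cdot> ar H f" and f\<theta>: "\<zeta> \<cdot> f = ar H f \<cdot> \<theta>"
    using f by (auto simp: bimod_arr_iff)
  note [simp] = modulesD(1-4)[OF bimodulesD(1)[OF bm(1)]] comodulesD(1-3)[OF bimodulesD(2)[OF bm(1)]]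
    modulesD(1-4)[OF bimodulesD(1)[OF bm(2)]] comodulesD(1-3)[OF bimodulesD(2)[OF bm(2)]]
  have Hinv: "ar H g \<cdot> ar H f = Id A (ob H a)" "ar H f \<cdot> ar H g = Id A (ob H b)"
    using arg_cong[OF inv(1), of "ar H"] arg_cong[OF inv(2), of "ar H"] by simp_all
  have "g \<cdot> k = h \<cdot> ar H g"
    by (rule H.A.inverse_square[OF fh[symmetric]]) (simp_all add: inv Hinv)
  moreover have "ar H g \<cdot> \<zeta> = \<theta> \<cdot> g"
    by (rule H.A.inverse_square[OF f\<theta>]) (simp_all add: inv Hinv)
  ultimately have "((b, k, \<zeta>), (a, h, \<theta>), g) \<in> Arr B"
    using bm by (simp add: bimod_arr_iff)
  with f show ?thesis
    by (intro category.is_isoI[OF bimod_category, where g = "((b, k, \<zeta>), (a, h, \<theta>), g)"])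
      (simp_all add: inv)
qed

text \<open>By freeness \<open>g\<close> is determined by \<open>w = g \<cdot> e a\<close>.
  Colinearity forces \<open>w\<close> to equalize \<open>ar H (e b)\<close> and
  \<open>e (ob H b)\<close>, and \<epsilon> contracts this pair, so \<open>w\<close> factors through
  \<open>e b\<close>.\<close>

lemma full_K:
  assumes iso: "\<And>a. a \<in> Obj A \<Longrightarrow> is_iso A (canon (ob H a) (m a))"
    and ab [simp]: "a \<in> Obj A" "b \<in> Obj A"
    and \<psi>: "\<psi> \<in> hom B (ob (K_e A H m \<delta>) a) (ob (K_e A H m \<delta>) b)"
  shows "\<exists>f \<in> hom A a b. ar (K_e A H m \<delta>) f = \<psi>"
proof -
  obtain g where g: "\<psi> = ((ob H a, m a, \<delta> a), (ob H b, m b, \<delta> b), g)"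
    and [simp]: "g \<in> Arr A" "Dom A g = ob H a" "Cod A g = ob H b"
    and gm: "g \<cdot> m a = m b \<cdot> ar H g" and g\<delta>: "\<delta> b \<cdot> g = ar H g \<cdot> \<delta> a"
    using \<psi> unfolding bimod_hom_iff K_ob bimod_arr_iff by blast
  define w where "w = g \<cdot> e a"
  have [simp]: "w \<in> Arr A" "Dom A w = a" "Cod A w = ob H b" by (simp_all add: w_def)
  have gw: "g = m b \<cdot> ar H w"
    unfolding w_def by (rule module_hom_free[OF ab(1) free_module]) (simp_all add: gm)
  let ?\<gamma> = "canon (ob H b) (m b)"
  \<comment> \<open>Both composites have the same image under the invertible
    \<open>?\<gamma>\<close>, namely \<open>\<delta> b \<cdot> w\<close>.\<close>
  have "?\<gamma> \<cdot> (ar H (e b) \<cdot> w) = \<delta> b \<cdot> w"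
    by (rule H.A.whisker_single[OF canon_free_e(1)]) simp_all
  also have "\<dots> = ar H g \<cdot> (\<delta> a \<cdot> e a)"
    by (simp add: w_def H.A.whisker[OF g\<delta>])
  also have "\<dots> = e (ob H b) \<cdot> w"
    by (simp add: w_def \<delta>_e nats)
  also have "\<dots> = ?\<gamma> \<cdot> (e (ob H b) \<cdot> w)"
    by (rule H.A.whisker_single[OF canon_free_e(2), symmetric]) simp_all
  finally have "ar H (e b) \<cdot> w = e (ob H b) \<cdot> w"
    by (rule H.A.iso_cancel_left[OF iso[OF ab(2)]]) simp_all
  then have "\<epsilon> (ob H b) \<cdot> (ar H (e b) \<cdot> w) = \<epsilon> (ob H b) \<cdot> (e (ob H b) \<cdot> w)" by simp
  moreover have "\<epsilon> (ob H b) \<cdot> (e (ob H b) \<cdot> w) = w"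
    by (rule \<epsilon>_e_whisker) simp_all
  moreover have "\<epsilon> (ob H b) \<cdot> (ar H (e b) \<cdot> w) = e b \<cdot> (\<epsilon> b \<cdot> w)"
    by (simp add: nats)
  ultimately have w: "w = e b \<cdot> (\<epsilon> b \<cdot> w)" by metis
  have "g = m b \<cdot> ar H (e b \<cdot> (\<epsilon> b \<cdot> w))"
    using gw w by metis
  also have "\<dots> = ar H (\<epsilon> b \<cdot> w)"
    by (simp add: units)
  finally have "g = ar H (\<epsilon> b \<cdot> w)" .
  moreover have "\<epsilon> b \<cdot> w \<in> hom A a b" by (simp add: H.A.hom_iff)
  ultimately show ?thesis
    unfolding g by (intro bexI[of _ "\<epsilon> b \<cdot> w"]) (simp_all add: K_ar)
qed

text \<open>
  Under the canonical isomorphism the coaction \<open>\<theta>\<close> becomes a coaction \<open>\<beta>\<close> of the comonad induced by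
  the free-forgetful adjunction. The pair \<open>\<beta>, e\<^sub>a\<close> is contractible by \<open>\<epsilon>\<^sub>a\<close>, so its equalizer is obtained
  by splitting the idempotent \<open>\<epsilon>\<^sub>a \<cdot> \<beta>\<close>.
\<close>

lemma eso_K:
  assumes cauchy: "cauchy_complete A"
    and iso: "\<And>a h. (a, h) \<in> modules A H m e \<Longrightarrow> is_iso A (canon a h)"
    and x: "(a, h, \<theta>) \<in> Bimod"
  shows "\<exists>b \<in> Obj A. \<exists>f \<in> hom B (ob (K_e A H m \<delta>) b) (a, h, \<theta>). is_iso B f"
proof -
  note mod = bimodulesD(1)[OF x] and com = bimodulesD(2)[OF x]
  note M = modulesD[OF mod] and D = comodulesD[OF com]
  note [simp] = M(1-4) D(1-3)
  obtain t' where [simp]: "t' \<in> Arr A" "Dom A t' = ob H a" "Cod A t' = ob H a"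
    and t': "canon a h \<cdot> t' = Id A (ob H a)"
    using iso[OF mod] by (rule H.A.is_isoE) simp
  define \<beta> where "\<beta> = t' \<cdot> \<theta>"
  have \<beta> [simp]: "\<beta> \<in> Arr A" "Dom A \<beta> = a" "Cod A \<beta> = ob H a" by (simp_all add: \<beta>_def)
  have t\<beta>: "canon a h \<cdot> \<beta> = \<theta>"
    unfolding \<beta>_def by (rule H.A.whisker_Id[OF t']) simp_all
  have "\<epsilon> a \<cdot> (canon a h \<cdot> \<beta>) = h \<cdot> \<beta>"
    by (rule H.A.whisker_single[OF \<epsilon>_canon[OF mod]]) simp_all
  then have h\<beta>: "h \<cdot> \<beta> = Id A a"
    by (simp add: t\<beta> D(5))
  have \<beta>_module: "\<beta> \<cdot> h = m a \<cdot> ar H \<beta>"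
  proof (rule H.A.iso_cancel_left[OF iso[OF mod]])
    have "canon a h \<cdot> (\<beta> \<cdot> h) = \<theta> \<cdot> h"
      by (rule H.A.whisker_single[OF t\<beta>]) simp_all
    also have "\<dots> = ar H h \<cdot> (l a \<cdot> ar H (canon a h \<cdot> \<beta>))"
      unfolding t\<beta> by (rule bimodulesD(3)[OF x])
    also have "\<dots> = canon a h \<cdot> (m a \<cdot> ar H \<beta>)"
      by (simp add: H.A.whisker_single[OF canon_module_hom[OF mod]])
    finally show "canon a h \<cdot> (\<beta> \<cdot> h) = canon a h \<cdot> (m a \<cdot> ar H \<beta>)" .
  qed simp_all
  have nat: "ar H \<beta> \<cdot> canon a h = canon (ob H a) (m a) \<cdot> ar H \<beta>"
    by (rule canon_natural[OF mod free_module]) (simp_all add: \<beta>_module)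
  \<comment> \<open>This is coassociativity of \<theta> transported to \<beta>: the invertible
    \<open>canon (ob H a) (m a)\<close> and \<open>ar H (canon a h)\<close> are placed in front of
    both sides and cancelled.\<close>
  have \<beta>\<beta>: "ar H \<beta> \<cdot> \<beta> = ar H (e a) \<cdot> \<beta>"
  proof (rule H.A.iso_cancel_left[OF iso[OF free_module[OF M(1)]]])
    show "canon (ob H a) (m a) \<cdot> (ar H \<beta> \<cdot> \<beta>) = canon (ob H a) (m a) \<cdot> (ar H (e a) \<cdot> \<beta>)"
    proof (rule H.A.iso_cancel_left[OF H.ar_iso[OF iso[OF mod]]])
      have "ar H (canon a h) \<cdot> (canon (ob H a) (m a) \<cdot> (ar H \<beta> \<cdot> \<beta>))
          = ar H (canon a h) \<cdot> (ar H \<beta> \<cdot> (canon a h \<cdot> \<beta>))"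
        by (simp add: H.A.whisker[OF nat])
      also have "\<dots> = ar H (canon a h \<cdot> \<beta>) \<cdot> (canon a h \<cdot> \<beta>)"
        by simp
      also have "\<dots> = \<delta> a \<cdot> (canon a h \<cdot> \<beta>)"
        unfolding t\<beta> by (rule D(4))
      also have "\<dots> = ar H (canon a h) \<cdot> (\<delta> a \<cdot> \<beta>)"
        by (rule H.A.whisker[OF \<delta>_canon[OF mod]]) simp_all
      also have "\<delta> a \<cdot> \<beta> = canon (ob H a) (m a) \<cdot> (ar H (e a) \<cdot> \<beta>)"
        by (rule H.A.whisker_single[OF canon_free_e(1), symmetric]) simp_all
      finally show "ar H (canon a h) \<cdot> (canon (ob H a) (m a) \<cdot> (ar H \<beta> \<cdot> \<beta>))
          = ar H (canon a h) \<cdot> (canon (ob H a) (m a) \<cdot> (ar H (e a) \<cdot> \<beta>))" .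
    qed simp_all
  qed simp_all
  define p where "p = \<epsilon> a \<cdot> \<beta>"
  have [simp]: "p \<in> Arr A" "Dom A p = a" "Cod A p = a" by (simp_all add: p_def)
  \<comment> \<open>The image of \<open>p\<close> lies in the equalizer of \<beta> and
    \<open>e a\<close>; idempotency of \<open>p\<close> follows because \<epsilon> splits
    \<open>e\<close>.\<close>
  have "\<beta> \<cdot> p = \<epsilon> (ob H a) \<cdot> (ar H \<beta> \<cdot> \<beta>)"
    by (simp add: p_def nats)
  also have "\<dots> = e a \<cdot> p"
    unfolding \<beta>\<beta> by (simp add: p_def nats)
  finally have \<beta>p: "\<beta> \<cdot> p = e a \<cdot> p" .
  have "p \<cdot> p = \<epsilon> a \<cdot> (\<beta> \<cdot> p)"
    unfolding p_def by simp
  also have "\<dots> = p"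
    unfolding \<beta>p by (rule \<epsilon>_e_whisker) simp_all
  finally have "p \<cdot> p = p" .
  moreover have "p \<in> hom A a a" by (simp add: H.A.hom_iff)
  ultimately obtain b r s where b [simp]: "b \<in> Obj A"
    and "r \<in> hom A a b" "s \<in> hom A b a" and sr: "s \<cdot> r = p" and rs: "r \<cdot> s = Id A b"
    using cauchy M(1) unfolding cauchy_complete_def by blast
  then have [simp]: "r \<in> Arr A" "Dom A r = a" "Cod A r = b"
    "s \<in> Arr A" "Dom A s = b" "Cod A s = a"
    by (auto simp: H.A.hom_iff)
  have "p \<cdot> s = s"
    by (simp add: sr[symmetric] rs)
  then have "\<beta> \<cdot> s = \<beta> \<cdot> (p \<cdot> s)" by simp
  also have "\<dots> = e a \<cdot> (p \<cdot> s)"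
    by (rule H.A.whisker[OF \<beta>p]) simp_all
  finally have \<beta>s: "\<beta> \<cdot> s = e a \<cdot> s"
    using \<open>p \<cdot> s = s\<close> by simp
  \<comment> \<open>\<open>?\<phi>\<close> is the module map out of the free module that extends the
    inclusion \<open>s\<close> of the equalizer; \<open>?\<phi>'\<close> corestricts \<beta> along
    \<open>r\<close>.\<close>
  let ?\<phi> = "h \<cdot> ar H s" and ?\<phi>' = "ar H r \<cdot> \<beta>"
  have \<beta>\<phi>: "\<beta> \<cdot> ?\<phi> = ar H s"
  proof -
    have "\<beta> \<cdot> ?\<phi> = m a \<cdot> ar H (\<beta> \<cdot> s)"
      by (simp add: H.A.whisker[OF \<beta>_module])
    also have "\<dots> = ar H s"
      unfolding \<beta>s by (simp add: units)
    finally show ?thesis .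
  qed
  have "?\<phi> \<cdot> m b = h \<cdot> ar H ?\<phi>"
    by (simp add: nats H.A.whisker[OF M(5)])
  moreover have "\<theta> \<cdot> ?\<phi> = ar H ?\<phi> \<cdot> \<delta> b"
  proof -
    have "\<theta> \<cdot> ?\<phi> = canon a h \<cdot> (\<beta> \<cdot> ?\<phi>)"
      by (rule H.A.whisker_single[OF t\<beta>, symmetric]) simp_all
    also have "\<dots> = ar H ?\<phi> \<cdot> \<delta> b"
      unfolding \<beta>\<phi> by (simp add: canon_def nats)
    finally show ?thesis .
  qed
  ultimately have arr: "((ob H b, m b, \<delta> b), (a, h, \<theta>), ?\<phi>) \<in> Arr B"
    unfolding bimod_arr_iff using x free_bimodule[OF b] by simp
  have "is_iso B ((ob H b, m b, \<delta> b), (a, h, \<theta>), ?\<phi>)"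
  proof (rule bimod_isoI[OF arr, where g = ?\<phi>'])
    have "?\<phi>' \<cdot> ?\<phi> = ar H r \<cdot> (\<beta> \<cdot> ?\<phi>)" by simp
    also have "\<dots> = ar H (r \<cdot> s)" unfolding \<beta>\<phi> by simp
    finally show "?\<phi>' \<cdot> ?\<phi> = Id A (ob H b)" unfolding rs by simp
    have "?\<phi> \<cdot> ?\<phi>' = h \<cdot> (ar H (s \<cdot> r) \<cdot> \<beta>)" by simp
    \<comment> \<open>Unfolding \<open>p\<close> exposes
      \<open>ar H \<beta> \<cdot> \<beta>\<close>, where coassociativity trades the inner \<beta>
      for \<open>e a\<close>, which \<epsilon> cancels.\<close>
    also have "\<dots> = h \<cdot> (ar H (\<epsilon> a) \<cdot> (ar H \<beta> \<cdot> \<beta>))" unfolding sr by (simp add: p_def)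
    also have "\<dots> = h \<cdot> (ar H (\<epsilon> a \<cdot> e a) \<cdot> \<beta>)" unfolding \<beta>\<beta> by simp
    also have "\<dots> = Id A a" using h\<beta> by (simp add: \<epsilon>_e)
    finally show "?\<phi> \<cdot> ?\<phi>' = Id A a" .
  qed simp_all
  with arr show ?thesis
    by (intro bexI[of _ b] bexI[of _ "((ob H b, m b, \<delta> b), (a, h, \<theta>), ?\<phi>)"])
      (simp_all add: bimod_hom_iff)
qed

lemma equivalence_of_canon_iso:
  assumes "cauchy_complete A"
    and iso: "\<And>a h. (a, h) \<in> modules A H m e \<Longrightarrow> is_iso A (canon a h)"
  shows "is_equivalence A B (K_e A H m \<delta>)"
proof -
  interpret K: cat_functor A B "K_e A H m \<delta>" by (rule K_functor)
  show ?thesis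
  proof (rule K.equivalenceI)
    show "f = g" if "f \<in> Arr A" "g \<in> Arr A" "Dom A f = Dom A g" "Cod A f = Cod A g"
      "ar (K_e A H m \<delta>) f = ar (K_e A H m \<delta>) g" for f g
      by (rule faithful_H) (use that in \<open>simp_all add: K_e_def\<close>)
    show "\<exists>f \<in> hom A a b. ar (K_e A H m \<delta>) f = \<psi>" if "a \<in> Obj A" "b \<in> Obj A"
      "\<psi> \<in> hom B (ob (K_e A H m \<delta>) a) (ob (K_e A H m \<delta>) b)" for a b \<psi>
      using that by (intro full_K iso free_module)
    show "\<exists>a \<in> Obj A. \<exists>f \<in> hom B (ob (K_e A H m \<delta>) a) x. is_iso B f" if x: "x \<in> Obj B" for x
    proof -
      obtain a h \<theta> where "x = (a, h, \<theta>)" by (cases x)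
      then show ?thesis using eso_K[OF assms] x by simp
    qed
  qed
qed

end

theorem theorem5p8:
  fixes A :: "('o, 'm) cat" and H :: "('o, 'm, 'o, 'm) ftr"
    and m e \<delta> \<epsilon> l :: "'o \<Rightarrow> 'm"
  assumes "cauchy_complete A"
    and "monad_comonad_triple A H m e \<delta> \<epsilon> l"
    and "\<And>a. a \<in> Obj A \<Longrightarrow> \<delta> a = l a \<cdot>\<^bsub>A\<^esub> ar H (e a)"
    and "\<And>a. a \<in> Obj A \<Longrightarrow> is_mono A (e a)"
  defines "cond_a \<equiv> is_equivalence A (bimod_cat A H m e \<delta> \<epsilon> l) (K_e A H m \<delta>)"
    and "cond_b \<equiv> (\<forall>(a, h) \<in> modules A H m e. is_iso A (ar H h \<cdot>\<^bsub>A\<^esub> \<delta> a))"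
    and "cond_c \<equiv> nat_iso A A (H \<cdot>\<cdot> H) (H \<cdot>\<cdot> H) (\<lambda>a. ar H (m a) \<cdot>\<^bsub>A\<^esub> \<delta> (ob H a))"
  shows "(cond_a \<longleftrightarrow> cond_b) \<and> (cond_b \<longleftrightarrow> cond_c) \<and>
         (cond_a \<and> is_augmentation A H m e \<epsilon> \<longrightarrow> hopf_monad A H m e \<delta> \<epsilon> l)"
proof -
  interpret unital_entwining A H m e \<delta> \<epsilon> l
    by (intro unital_entwining.intro unital_entwining_axioms.intro assms(2-4))
  have b: "cond_b \<longleftrightarrow> (\<forall>a h. (a, h) \<in> modules A H m e \<longrightarrow> is_iso A (canon a h))"
    unfolding cond_b_def canon_def by blast
  have ab: "cond_a \<longleftrightarrow> cond_b"
    unfolding b cond_a_def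
    using canon_iso_of_equivalence equivalence_of_canon_iso[OF assms(1)] by blast
  \<comment> \<open>The composite in \<open>cond_c\<close> consists of the canonical maps on free
    modules: one direction specializes, the other descends from free modules to all modules.\<close>
  have bc: "cond_b \<longleftrightarrow> cond_c"
    unfolding b cond_c_def canon_free_iso_iff using canon_iso_of_free free_module by blast
  have "hopf_monad A H m e \<delta> \<epsilon> l" if "cond_c" "is_augmentation A H m e \<epsilon>"
    using that unfolding cond_c_def by (rule hopf_monad_of_augmentation)
  with ab bc show ?thesis by blast
qed

end
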